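(* Let $G=(V,E)$ be a finite graph with an orientation $\varepsilon$, and let $\mathbbm k\in\{\mathbb Z,\mathbb Q,\mathbb R,\mathbb C\}$. Let $\lambda$ be the unique translation-invariant product valuation on the Boolean algebra of $\Omega(G,\varepsilon;\mathbbm k)=T(G,\varepsilon;\mathbbm k)\times F(G,\varepsilon;\mathbbm k)$ generated by products of cosets of subgroups (subspaces if $\mathbbm k$ is a field), with values in $\mathbb Q[x,y]$, satisfying $\lambda(A_1\times A_2)=\frac{|\mathrm{Tor}(T)|}{|\mathrm{Tor}(T/A_1)|}x^{\operatorname{rank}A_1}\frac{|\mathrm{Tor}(F)|}{|\mathrm{Tor}(F/A_2)|}y^{\operatorname{rank}A_2}$. Let $\mathcal A(G)$ be the tension-flow arrangement $\{\Omega_e: e\in E\}$ of $\Omega(G,\varepsilon;\mathbbm k)$, and $\Omega_{\rm nz}(G)=\Omega(G,\varepsilon;\mathbbm k)-\bigcup_{e\in E}\Omega_e$. Then for all finite abelian groups $A,B$ with $|A|=p$, $|B|=q$, \[ |\Omega_{\rm nz}(G,\varepsilon;A,B)|=\chi(\mathcal A(G);p,q)=\lambda(\Omega_{\rm nz}(G))\big|_{(x,y)=(p,q)}, \] and, as polynomials, \[ \chi(\mathcal A(G);x,y)=\lambda(\Omega_{\rm nz}(G))=\sum_{X\subseteq E}(-1)^{|X|}x^{r\langle E\rangle-r\langle X\rangle}y^{n\langle E-X\rangle}. \]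
   Context: Graphs may have loops and multiple edges. An orientation assigns a direction to each edge. For an abelian group $A$, a tension $f:E\to A$ of $(G,\varepsilon)$ is a function such that for every circuit $C$ with a chosen direction of traversal, $\sum_{e\in C}\pm f(e)=0$, with sign $+$ if $\varepsilon$ agrees with the traversal on $e$ and $-$ otherwise; $T(G,\varepsilon;A)$ is the group of tensions. A flow $g:E\to A$ satisfies $\sum_{e}\varepsilon(v,e)g(e)=0$ at every vertex $v$, where $\varepsilon(v,e)=1$ if $e$ is a non-loop leaving $v$, $-1$ if entering $v$, $0$ otherwise (loops contribute $0$); $F(G,\varepsilon;A)$ is the flow group. $\Omega(G,\varepsilon;A,B)=T(G,\varepsilon;A)\times F(G,\varepsilon;B)$; $\Omega_{\rm nz}(G,\varepsilon;A,B)$ is the set of $(f,g)$ with $(f(e),g(e))\neq(0,0)$ for all $e$. $\Omega_e=\{(f,g):f(e)=0,g(e)=0\}$. For $X\subseteq E$, $\langle X\rangle=(V,X)$, $r\langle X\rangle=|V|-c\langle X\rangle$ (number of edges of a maximal spanning forest; $c$ = number of components), $n\langle X\rangle=|X|-r\langle X\rangle$. $\mathrm{Tor}$ is the torsion subgroup. The multivariable characteristic polynomial of an arrangement $\mathcal A$ of products of cosets in $\Omega_1\times\Omega_2$ is $\chi(\mathcal A;x,y)=\sum_{X\in L(\mathcal A)}\mu(X,\Omega)\frac{|\mathrm{Tor}\Omega_1|}{|\mathrm{Tor}(\Omega_1/\pi_1\langle X\rangle)|}x^{\operatorname{rank}\pi_1\langle X\rangle}\frac{|\mathrm{Tor}\Omega_2|}{|\mathrm{Tor}(\Omega_2/\pi_2\langle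 X\rangle)|}y^{\operatorname{rank}\pi_2\langle X\rangle}$, where $L(\mathcal A)$ is the poset (under inclusion) of non-empty intersections of members of $\mathcal A$ including $\Omega$, $\mu$ its Möbius function, and $\pi_i\langle X\rangle$ the subgroup of which the projection $\pi_i(X)$ is a coset. *)

theory Defs
  imports
    Complex_Main
    "HOL-Library.Cardinality"
    "HOL-Library.Function_Algebras"
    "HOL-Library.Product_Plus"
    "HOL-Computational_Algebra.Polynomial"
    "HOL-Algebra.Coset"
    "Graph_Theory.Graph_Theory"
begin

section \<open>Graphs, tensions and flows\<close>

text \<open>
  A graph (loops and multiple edges allowed) together with an orientation is a
  \<open>pre_digraph\<close>: the orientation directs the edge \<open>e\<close> from \<open>tail G e\<close> to \<open>head G e\<close>.
  The underlying unoriented graph is accessed through \<open>traversals\<close>, in which every edge occurs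
  twice: \<open>(e, True)\<close> traverses \<open>e\<close> along the orientation and \<open>(e, False)\<close> against it.
\<close>

definition traversals :: "('v, 'e) pre_digraph \<Rightarrow> ('v, 'e \<times> bool) pre_digraph" where
  "traversals G =
    \<lparr>verts = verts G, arcs = arcs G \<times> UNIV,
     tail = (\<lambda>(e, s). if s then tail G e else head G e),
     head = (\<lambda>(e, s). if s then head G e else tail G e)\<rparr>"

text \<open>
  The distinctness of the edges only excludes going back and forth along one single edge, which
  is a cycle of the digraph \<open>traversals G\<close> but not a circuit of the graph.
\<close>

definition directed_circuit :: "('v, 'e) pre_digraph \<Rightarrow> ('e \<times> bool) list \<Rightarrow> bool" where
  "directed_circuit G c \<longleftrightarrow> pre_digraph.cycle (traversals G) c \<and> distinct (map fst c)"

text \<open>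
  A function on the edge set is represented by a function on the edge type that vanishes outside
  \<open>arcs G\<close>.
\<close>

definition tensions :: "('v, 'e) pre_digraph \<Rightarrow> ('e \<Rightarrow> 'a::ab_group_add) set" where
  "tensions G = {f. (\<forall>e. e \<notin> arcs G \<longrightarrow> f e = 0) \<and>
     (\<forall>c. directed_circuit G c \<longrightarrow> (\<Sum>(e, s)\<leftarrow>c. if s then f e else - f e) = 0)}"

definition incidence :: "('v, 'e) pre_digraph \<Rightarrow> 'v \<Rightarrow> 'e \<Rightarrow> int" where
  "incidence G v e =
    (if tail G e = head G e then 0
     else if tail G e = v then 1
     else if head G e = v then - 1
     else 0)"

definition sign_mult :: "int \<Rightarrow> 'a::ab_group_add \<Rightarrow> 'a" where
  "sign_mult s a = (if s = 1 then a else if s = - 1 then - a else 0)"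

definition flows :: "('v, 'e) pre_digraph \<Rightarrow> ('e \<Rightarrow> 'a::ab_group_add) set" where
  "flows G = {g. (\<forall>e. e \<notin> arcs G \<longrightarrow> g e = 0) \<and>
     (\<forall>v\<in>verts G. (\<Sum>e\<in>arcs G. sign_mult (incidence G v e) (g e)) = 0)}"

definition Omega ::
  "('v, 'e) pre_digraph \<Rightarrow> (('e \<Rightarrow> 'a::ab_group_add) \<times> ('e \<Rightarrow> 'b::ab_group_add)) set" where
  "Omega G = tensions G \<times> flows G"

definition Omega_nz ::
  "('v, 'e) pre_digraph \<Rightarrow> (('e \<Rightarrow> 'a::ab_group_add) \<times> ('e \<Rightarrow> 'b::ab_group_add)) set" where
  "Omega_nz G = {(f, g) \<in> Omega G. \<forall>e\<in>arcs G. (f e, g e) \<noteq> (0, 0)}"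

definition Omega_edge ::
  "('v, 'e) pre_digraph \<Rightarrow> 'e \<Rightarrow> (('e \<Rightarrow> 'a::ab_group_add) \<times> ('e \<Rightarrow> 'b::ab_group_add)) set" where
  "Omega_edge G e = {(f, g) \<in> Omega G. f e = 0 \<and> g e = 0}"

definition tf_arrangement ::
  "('v, 'e) pre_digraph \<Rightarrow> (('e \<Rightarrow> 'k::ab_group_add) \<times> ('e \<Rightarrow> 'k)) set set" where
  "tf_arrangement G = Omega_edge G ` arcs G"

definition num_components :: "('v, 'e) pre_digraph \<Rightarrow> nat" where
  "num_components G = card (pre_digraph.sccs_verts (with_proj (mk_symmetric G)))"

text \<open>
  Rank and nullity of the spanning subgraph with edge set \<open>X\<close>. No truncation occurs in the
  subtractions when \<open>X \<subseteq> arcs G\<close> and \<open>G\<close> is finite.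
\<close>

definition graph_rank :: "('v, 'e) pre_digraph \<Rightarrow> 'e set \<Rightarrow> nat" where
  "graph_rank G X = card (verts G) - num_components (G\<lparr>arcs := X\<rparr>)"

definition graph_nullity :: "('v, 'e) pre_digraph \<Rightarrow> 'e set \<Rightarrow> nat" where
  "graph_nullity G X = card X - graph_rank G X"


section \<open>Polynomials in two variables\<close>

text \<open>
  $\mathbf{Q}[x,y]$ is represented as $\mathbf{Q}[x][y]$: the variable of the outer polynomial
  is $y$, the one of the coefficients is $x$.
\<close>

definition var_x :: "rat poly poly" where
  "var_x = [:[:0, 1:]:]"

definition var_y :: "rat poly poly" where
  "var_y = [:0, 1:]"

definition eval2 :: "rat poly poly \<Rightarrow> rat \<Rightarrow> rat \<Rightarrow> rat" where
  "eval2 P a b = poly (poly P [:b:]) a"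


section \<open>Submodules, rank and torsion\<close>

text \<open>
  The ambient module is that of functions \<open>'e \<Rightarrow> 'k\<close> with pointwise operations. Submodules are
  subgroups if \<open>'k\<close> is \<open>int\<close> and subspaces if \<open>'k\<close> is a field; \<open>mod_rank\<close> is the rank of an
  abelian group in the first case and the dimension in the second.
\<close>

definition fscale :: "'k::comm_ring_1 \<Rightarrow> ('e \<Rightarrow> 'k) \<Rightarrow> 'e \<Rightarrow> 'k" where
  "fscale c f = (\<lambda>e. c * f e)"

definition submod :: "('e \<Rightarrow> 'k::comm_ring_1) set \<Rightarrow> bool" where
  "submod H \<longleftrightarrow> module.subspace fscale H"

definition mod_rank :: "('e \<Rightarrow> 'k::comm_ring_1) set \<Rightarrow> nat" where
  "mod_rank H = Max {card S |S. S \<subseteq> H \<and> finite S \<and> \<not> module.dependent fscale S}"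

definition cosets_in :: "('e \<Rightarrow> 'k::comm_ring_1) set \<Rightarrow> ('e \<Rightarrow> 'k) set set" where
  "cosets_in M = {(+) a ` H |a H. a \<in> M \<and> submod H \<and> H \<subseteq> M}"

definition direction :: "('e \<Rightarrow> 'k::comm_ring_1) set \<Rightarrow> ('e \<Rightarrow> 'k) set" where
  "direction C = (THE H. submod H \<and> (\<exists>a. C = (+) a ` H))"

definition add_monoid_on :: "'m::ab_group_add set \<Rightarrow> 'm monoid" where
  "add_monoid_on M = \<lparr>carrier = M, monoid.mult = (+), one = 0\<rparr>"

definition Tor :: "('m, 'r) monoid_scheme \<Rightarrow> 'm set" where
  "Tor M = {a \<in> carrier M. \<exists>n::nat. n > 0 \<and> a [^]\<^bsub>M\<^esub> n = \<one>\<^bsub>M\<^esub>}"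

definition coset_weight ::
  "('e \<Rightarrow> 'k::comm_ring_1) set \<Rightarrow> ('e \<Rightarrow> 'k) set \<Rightarrow> rat poly poly \<Rightarrow> rat poly poly" where
  "coset_weight M H z =
    [:[: of_nat (card (Tor (add_monoid_on M))) / of_nat (card (Tor (add_monoid_on M Mod H))) :]:]
    * z ^ mod_rank H"


section \<open>Characteristic polynomial of an arrangement\<close>

function moebius :: "'p::order set \<Rightarrow> 'p \<Rightarrow> 'p \<Rightarrow> int" where
  "moebius P a b =
    (if finite P \<and> a \<in> P \<and> b \<in> P \<and> a \<le> b
     then if a = b then 1 else - (\<Sum>c\<in>{c \<in> P. a \<le> c \<and> c < b}. moebius P a c)
     else 0)"
  by auto
termination
  by (relation "measure (\<lambda>(P, a, b). card {c \<in> P. c < b})")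
     (auto intro!: psubset_card_mono)

declare moebius.simps [simp del]

definition intersection_poset :: "'m set \<Rightarrow> 'm set set \<Rightarrow> 'm set set" where
  "intersection_poset M \<A> = {M \<inter> \<Inter>\<B> |\<B>. \<B> \<subseteq> \<A>} - {{}}"

definition char_poly ::
  "('e \<Rightarrow> 'k::comm_ring_1) set \<Rightarrow> ('e \<Rightarrow> 'k) set \<Rightarrow> (('e \<Rightarrow> 'k) \<times> ('e \<Rightarrow> 'k)) set set
    \<Rightarrow> rat poly poly" where
  "char_poly M1 M2 \<A> =
    (\<Sum>X\<in>intersection_poset (M1 \<times> M2) \<A>.
       of_int (moebius (intersection_poset (M1 \<times> M2) \<A>) X (M1 \<times> M2))
       * coset_weight M1 (direction (fst ` X)) var_x
       * coset_weight M2 (direction (snd ` X)) var_y)"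

definition tf_char_poly :: "'k::comm_ring_1 itself \<Rightarrow> ('v, 'e) pre_digraph \<Rightarrow> rat poly poly" where
  "tf_char_poly K G =
    char_poly (tensions G :: ('e \<Rightarrow> 'k) set) (flows G) (tf_arrangement G)"


section \<open>Valuations\<close>

inductive_set generated_algebra :: "'m set \<Rightarrow> 'm set set \<Rightarrow> 'm set set"
  for M :: "'m set" and \<G> :: "'m set set" where
  empty: "{} \<in> generated_algebra M \<G>"
| basic: "S \<in> \<G> \<Longrightarrow> S \<in> generated_algebra M \<G>"
| compl: "S \<in> generated_algebra M \<G> \<Longrightarrow> M - S \<in> generated_algebra M \<G>"
| union: "S \<in> generated_algebra M \<G> \<Longrightarrow> S' \<in> generated_algebra M \<G>
    \<Longrightarrow> S \<union> S' \<in> generated_algebra M \<G>"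

definition coset_algebra :: "('e \<Rightarrow> 'k::comm_ring_1) set \<Rightarrow> ('e \<Rightarrow> 'k) set set" where
  "coset_algebra M = generated_algebra M (cosets_in M)"

definition product_coset_algebra ::
  "('e \<Rightarrow> 'k::comm_ring_1) set \<Rightarrow> ('e \<Rightarrow> 'k) set \<Rightarrow> (('e \<Rightarrow> 'k) \<times> ('e \<Rightarrow> 'k)) set set" where
  "product_coset_algebra M1 M2 =
    generated_algebra (M1 \<times> M2) {C1 \<times> C2 |C1 C2. C1 \<in> cosets_in M1 \<and> C2 \<in> cosets_in M2}"

definition valuation_on :: "'m set set \<Rightarrow> ('m set \<Rightarrow> 'r::comm_ring_1) \<Rightarrow> bool" where
  "valuation_on \<B> v \<longleftrightarrow> v {} = 0 \<and>
    (\<forall>S\<in>\<B>. \<forall>S'\<in>\<B>. v (S \<union> S') = v S + v S' - v (S \<inter> S'))"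

definition translation_invariant_on ::
  "'m::ab_group_add set \<Rightarrow> 'm set set \<Rightarrow> ('m set \<Rightarrow> 'r) \<Rightarrow> bool" where
  "translation_invariant_on M \<B> v \<longleftrightarrow> (\<forall>a\<in>M. \<forall>S\<in>\<B>. v ((+) a ` S) = v S)"

text \<open>
  These properties determine the values on \<open>product_coset_algebra M1 M2\<close>; nothing is
  required of the values on other sets.
\<close>

definition ti_product_valuation ::
  "('e \<Rightarrow> 'k::comm_ring_1) set \<Rightarrow> ('e \<Rightarrow> 'k) set
    \<Rightarrow> ((('e \<Rightarrow> 'k) \<times> ('e \<Rightarrow> 'k)) set \<Rightarrow> rat poly poly) \<Rightarrow> bool" where
  "ti_product_valuation M1 M2 v \<longleftrightarrow>
    valuation_on (product_coset_algebra M1 M2) v \<and>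
    translation_invariant_on (M1 \<times> M2) (product_coset_algebra M1 M2) v \<and>
    (\<exists>v1 v2.
       valuation_on (coset_algebra M1) v1 \<and> translation_invariant_on M1 (coset_algebra M1) v1 \<and>
       valuation_on (coset_algebra M2) v2 \<and> translation_invariant_on M2 (coset_algebra M2) v2 \<and>
       (\<forall>S1\<in>coset_algebra M1. \<forall>S2\<in>coset_algebra M2. v (S1 \<times> S2) = v1 S1 * v2 S2)) \<and>
    (\<forall>H1 H2. submod H1 \<and> H1 \<subseteq> M1 \<and> submod H2 \<and> H2 \<subseteq> M2 \<longrightarrow>
       v (H1 \<times> H2) = coset_weight M1 H1 var_x * coset_weight M2 H2 var_y)"

definition tf_valuation ::
  "('v, 'e) pre_digraph
    \<Rightarrow> ((('e \<Rightarrow> 'k::comm_ring_1) \<times> ('e \<Rightarrow> 'k)) set \<Rightarrow> rat poly poly) \<Rightarrow> bool" where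
  "tf_valuation G v \<longleftrightarrow> ti_product_valuation (tensions G) (flows G) v"

end

theory Submission
  imports Defs
begin

text \<open>
  For a set \<open>X\<close> of edges, the tensions vanishing on \<open>X\<close> and the flows vanishing on \<open>X\<close> are free, with
  the same coordinates over every coefficient group: if edges are added greedily to a spanning forest
  of \<open>X\<close>, a tension vanishing on \<open>X\<close> is determined by arbitrary values on the edges that join two
  components, and a flow vanishing on \<open>X\<close> by arbitrary values on the edges of the
  complement of \<open>X\<close> outside one of its spanning forests. These coordinates give cardinalities over finite groups and ranks over
  integral domains of characteristic zero, where moreover no torsion occurs. Counting, the
  valuation, and the characteristic polynomial (Whitney's formula for the Moebius function) are then
  the same inclusion-exclusion sum over \<open>X\<close>.
\<close>

section \<open>Connectivity and rank\<close>

text \<open>Circuit conditions show neither free coordinates nor closure under sums. Both become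
  visible through potentials: a function on the edges is a tension exactly when it is a difference
  of vertex values. The exponents are edge counts. Each joining edge lowers the number of components
  by one, so r<E> - r<X> edges join components when X grows to E, and n<E-X> edges of E - X stay
  outside a spanning forest of E - X. Over the integers nothing can be divided. Ranks are bounded by
  elimination with cross-multiplication, and quotients by the subgroups that occur have no torsion
  because n f(e) = 0 with n > 0 forces f(e) = 0: the vanishing conditions cut out saturated
  subgroups. Different X can give the same intersection Y, so the characteristic polynomial has in
  general fewer terms than the subset sum. The link is that mu(Y, \<Omega>) is the sum of (-1)^|X|
  over all X with intersection Y. This needs every \<Omega>_e to be proper, for two different
  reasons: a loop carries a non-zero flow, any other edge a non-zero tension.\<close>

text \<open>The relation is reflexive on the whole vertex type, so components are counted below as
  classes of members of \<open>verts G\<close>.\<close>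

definition conn :: "('v, 'e) pre_digraph \<Rightarrow> 'e set \<Rightarrow> ('v \<times> 'v) set" where
  "conn G X = (\<Union>e\<in>X. {(tail G e, head G e), (head G e, tail G e)})\<^sup>*"

lemma conn_refl [simp]: "(u, u) \<in> conn G X"
  by (simp add: conn_def)

lemma conn_trans: "(u, v) \<in> conn G X \<Longrightarrow> (v, w) \<in> conn G X \<Longrightarrow> (u, w) \<in> conn G X"
  by (auto simp: conn_def)

lemma conn_sym: "(u, v) \<in> conn G X \<Longrightarrow> (v, u) \<in> conn G X"
proof -
  have "sym (conn G X)"
    unfolding conn_def by (rule sym_rtrancl) (auto simp: sym_def)
  then show "(u, v) \<in> conn G X \<Longrightarrow> (v, u) \<in> conn G X"
    by (auto dest: symD)
qed

lemma conn_edge: "e \<in> X \<Longrightarrow> (tail G e, head G e) \<in> conn G X"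
  unfolding conn_def by (rule r_into_rtrancl) auto

lemma conn_mono: "X \<subseteq> Y \<Longrightarrow> conn G X \<subseteq> conn G Y"
  unfolding conn_def by (rule rtrancl_mono) auto

lemma conn_class_eq_iff: "conn G X `` {u} = conn G X `` {v} \<longleftrightarrow> (u, v) \<in> conn G X"
  by (auto intro: conn_trans conn_sym)

lemma conn_induct [consumes 1, case_names refl fwd bwd]:
  assumes "(u, v) \<in> conn G X" "P u"
    and "\<And>e. e \<in> X \<Longrightarrow> (u, tail G e) \<in> conn G X \<Longrightarrow> P (tail G e) \<Longrightarrow> P (head G e)"
    and "\<And>e. e \<in> X \<Longrightarrow> (u, head G e) \<in> conn G X \<Longrightarrow> P (head G e) \<Longrightarrow> P (tail G e)"
  shows "P v"
  using assms(1) unfolding conn_def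
proof (induction rule: rtrancl_induct)
  case (step y z)
  then show ?case using assms(3,4) by (auto simp flip: conn_def)
qed (fact assms(2))

lemma conn_const:
  assumes "(u, v) \<in> conn G X" "\<And>e. e \<in> X \<Longrightarrow> p (head G e) = p (tail G e)"
  shows "p v = p u"
  using assms(1) by (induction rule: conn_induct) (simp_all add: assms(2))

text \<open>\<open>S\<close> is the union of the two classes that \<open>e\<close> joins. The
  right-hand side is closed under steps along \<open>e\<close> and along \<open>X\<close>, and any
  two points of \<open>S\<close> are linked through \<open>tail G e\<close>.\<close>

lemma conn_insert:
  fixes G X e
  defines "S \<equiv> conn G X `` {tail G e} \<union> conn G X `` {head G e}"
  shows "conn G (insert e X) = conn G X \<union> S \<times> S"
proof (intro equalityI subsetI)
  fix z assume z: "z \<in> conn G (insert e X)"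
  obtain u v where [simp]: "z = (u, v)" by fastforce
  have "(u, v) \<in> conn G (insert e X)" using z by simp
  then have "(u, v) \<in> conn G X \<union> S \<times> S"
  proof (induction rule: conn_induct)
    case (fwd d)
    then show ?case using conn_edge[of d X G]
      by (auto simp: S_def intro: conn_trans conn_sym)
  next
    case (bwd d)
    then show ?case using conn_edge[of d X G, THEN conn_sym]
      by (auto simp: S_def intro: conn_trans conn_sym)
  qed simp
  then show "z \<in> conn G X \<union> S \<times> S" by simp
next
  fix z assume z: "z \<in> conn G X \<union> S \<times> S"
  have 1: "conn G X \<subseteq> conn G (insert e X)" by (rule conn_mono) auto
  have 2: "(tail G e, head G e) \<in> conn G (insert e X)" by (rule conn_edge) simp
  have S: "(tail G e, s) \<in> conn G (insert e X)" if "s \<in> S" for s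
    using that 1 2 unfolding S_def by (auto intro: conn_trans)
  show "z \<in> conn G (insert e X)"
    using z 1 by (cases z) (auto intro: conn_trans[OF conn_sym[OF S] S])
qed

lemma conn_insert_conn:
  assumes "(tail G e, head G e) \<in> conn G X"
  shows "conn G (insert e X) = conn G X"
  using assms unfolding conn_insert
  by auto (meson conn_sym conn_trans)+

context fin_digraph
begin

lemma conn_in_verts:
  assumes "X \<subseteq> arcs G" "(u, v) \<in> conn G X" "u \<in> verts G"
  shows "v \<in> verts G"
  using assms(2) by (induction rule: conn_induct) (use assms in auto)

text \<open>In the symmetrised digraph reachability is symmetric, so its strongly connected
  components are the classes of \<open>conn\<close>. All later rank arguments work with these
  classes.\<close>

lemma num_components_eq:
  assumes "X \<subseteq> arcs G"
  shows "num_components (G\<lparr>arcs := X\<rparr>) = card ((\<lambda>v. conn G X `` {v}) ` verts G)"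
proof -
  let ?H = "with_proj (mk_symmetric (G\<lparr>arcs := X\<rparr>))"
  have ends: "arcs_ends ?H = (\<Union>e\<in>X. {(tail G e, head G e), (head G e, tail G e)})"
    by (auto simp: mk_symmetric_def)
  have reach: "u \<rightarrow>\<^sup>*\<^bsub>?H\<^esub> v \<longleftrightarrow> u \<in> verts G \<and> (u, v) \<in> conn G X" for u v
  proof
    assume "u \<rightarrow>\<^sup>*\<^bsub>?H\<^esub> v"
    then have "(u, v) \<in> (arcs_ends ?H)\<^sup>*" "u \<in> verts G"
      by (rule reachable_rtranclI) (use \<open>u \<rightarrow>\<^sup>*\<^bsub>?H\<^esub> v\<close> in \<open>auto elim: reachable_in_vertsE\<close>)
    then show "u \<in> verts G \<and> (u, v) \<in> conn G X"
      unfolding ends conn_def by simp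
  next
    assume "u \<in> verts G \<and> (u, v) \<in> conn G X"
    then have "(u, v) \<in> conn G X" "u \<in> verts G" by auto
    then show "u \<rightarrow>\<^sup>*\<^bsub>?H\<^esub> v"
    proof (induction rule: conn_induct)
      case refl
      then show ?case by (simp add: reachable_def rtrancl_on_refl)
    next
      case (fwd e)
      then show ?case using assms unfolding reachable_def ends
        by (auto intro!: rtrancl_on_into_rtrancl_on[of _ "tail G e"])
    next
      case (bwd e)
      then show ?case using assms unfolding reachable_def ends
        by (auto intro!: rtrancl_on_into_rtrancl_on[of _ "head G e"])
    qed
  qed
  have "pre_digraph.sccs_verts ?H = (\<lambda>v. conn G X `` {v}) ` verts G"
  proof (intro equalityI subsetI)
    fix S assume S: "S \<in> pre_digraph.sccs_verts ?H"
    then obtain u where u: "u \<in> S" by (auto simp: pre_digraph.sccs_verts_def)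
    with S have "u \<in> verts G" by (auto simp: pre_digraph.sccs_verts_def reach)
    moreover have "S = conn G X `` {u}"
      using S u conn_in_verts[OF assms] unfolding pre_digraph.sccs_verts_def reach
      by (auto dest: conn_sym) (metis conn_sym)
    ultimately show "S \<in> (\<lambda>v. conn G X `` {v}) ` verts G" by auto
  next
    fix S assume "S \<in> (\<lambda>v. conn G X `` {v}) ` verts G"
    then obtain u where "u \<in> verts G" "S = conn G X `` {u}" by auto
    moreover from this have "u \<in> S" by simp
    then have "S \<noteq> {}" by blast
    ultimately show "S \<in> pre_digraph.sccs_verts ?H"
      unfolding pre_digraph.sccs_verts_def reach
      using conn_in_verts[OF assms] by (auto intro: conn_trans conn_sym)
  qed
  then show ?thesis by (simp add: num_components_def)
qed

lemma graph_rank_empty: "graph_rank G {} = 0"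
proof -
  have "(\<lambda>v. conn G {} `` {v}) ` verts G = (\<lambda>v. {v}) ` verts G"
    by (auto simp: conn_def)
  then show ?thesis
    by (simp add: graph_rank_def num_components_eq card_image)
qed

lemma graph_rank_insert_conn:
  assumes "X \<subseteq> arcs G" "e \<in> arcs G" "(tail G e, head G e) \<in> conn G X"
  shows "graph_rank G (insert e X) = graph_rank G X"
  using assms by (simp add: graph_rank_def num_components_eq conn_insert_conn)

lemma graph_rank_insert_not_conn:
  assumes "X \<subseteq> arcs G" "e \<in> arcs G" "(tail G e, head G e) \<notin> conn G X"
  shows "graph_rank G (insert e X) = Suc (graph_rank G X)"
proof -
  define c where "c v = conn G X `` {v}" for v
  let ?S = "c (tail G e)" and ?T = "c (head G e)"
  have iff: "c u = c v \<longleftrightarrow> v \<in> c u" for u v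
    using conn_class_eq_iff[of G X u v] by (auto simp: c_def)
  have self: "v \<in> c v" for v by (simp add: c_def)
  have new: "conn G (insert e X) `` {v} = (if v \<in> ?S \<union> ?T then ?S \<union> ?T else c v)" for v
  proof -
    have "c v \<subseteq> ?S \<union> ?T" if "v \<in> ?S \<union> ?T"
      using that by (auto simp flip: iff)
    moreover have "conn G (insert e X) = conn G X \<union> (?S \<union> ?T) \<times> (?S \<union> ?T)"
      unfolding conn_insert c_def ..
    ultimately show ?thesis by (auto simp: c_def)
  qed
  have ne: "?S \<noteq> ?T" using assms(3) by (auto simp: iff) (auto simp: c_def)
  have img: "(\<lambda>v. conn G (insert e X) `` {v}) ` verts G = insert (?S \<union> ?T) (c ` verts G - {?S, ?T})"
  proof -
    have "tail G e \<in> verts G" using assms by auto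
    moreover have "v \<in> ?S \<union> ?T \<longleftrightarrow> c v \<in> {?S, ?T}" for v
      using iff[of "tail G e" v] iff[of "head G e" v] by auto
    ultimately show ?thesis unfolding new using self by (auto simp: image_iff)
  qed
  \<comment> \<open>The merged class is new, since an old class containing both ends of
    \<open>e\<close> would make \<open>?S\<close> and \<open>?T\<close> equal. So exactly one
    component is lost, not two.\<close>
  have "?S \<union> ?T \<noteq> c v" for v
  proof
    assume eq: "?S \<union> ?T = c v"
    then have "tail G e \<in> c v" "head G e \<in> c v" using self by auto
    then show False using ne by (simp flip: iff)
  qed
  then have notin: "?S \<union> ?T \<notin> c ` verts G - {?S, ?T}" by blast
  have sub: "{?S, ?T} \<subseteq> c ` verts G" using assms by auto
  have two: "card {?S, ?T} = 2" using ne by simp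
  \<comment> \<open>With the bound by \<open>card (verts G)\<close> below, this keeps the
    natural-number subtractions exact.\<close>
  have le: "2 \<le> card (c ` verts G)"
    using card_mono[OF _ sub] two by simp
  have "card (insert (?S \<union> ?T) (c ` verts G - {?S, ?T})) = Suc (card (c ` verts G) - 2)"
    using notin card_Diff_subset[OF _ sub] two by simp
  moreover have "card (c ` verts G) \<le> card (verts G)"
    by (rule card_image_le) simp
  moreover have "num_components (G\<lparr>arcs := X\<rparr>) = card (c ` verts G)"
    using assms by (simp add: num_components_eq c_def)
  moreover have "num_components (G\<lparr>arcs := insert e X\<rparr>)
      = card (insert (?S \<union> ?T) (c ` verts G - {?S, ?T}))"
    using assms num_components_eq[of "insert e X"] by (simp only: img) simp
  ultimately show ?thesis using le by (simp add: graph_rank_def)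
qed

end

text \<open>A derivation fixes an order in which the edges of \<open>Y - X\<close> are added;
  \<open>F\<close> collects those that join two classes at their turn. Rule induction then extends
  potentials and flows by one edge at a time.\<close>

inductive forest_ext :: "('v, 'e) pre_digraph \<Rightarrow> 'e set \<Rightarrow> 'e set \<Rightarrow> 'e set \<Rightarrow> bool"
  for G X where
  start: "forest_ext G X X {}"
| closed: "forest_ext G X Y F \<Longrightarrow> e \<notin> Y \<Longrightarrow> (tail G e, head G e) \<in> conn G Y
    \<Longrightarrow> forest_ext G X (insert e Y) F"
| bridge: "forest_ext G X Y F \<Longrightarrow> e \<notin> Y \<Longrightarrow> (tail G e, head G e) \<notin> conn G Y
    \<Longrightarrow> forest_ext G X (insert e Y) (insert e F)"

lemma forest_ext_subset: "forest_ext G X Y F \<Longrightarrow> X \<subseteq> Y \<and> F \<subseteq> Y - X"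
  by (induction rule: forest_ext.induct) auto

lemma ex_forest_ext:
  assumes "finite Y" "X \<subseteq> Y"
  shows "\<exists>F. forest_ext G X Y F"
proof -
  have "\<exists>F. forest_ext G X (X \<union> Z) F" if "finite Z" for Z
    using that
  proof (induction Z)
    case empty
    then show ?case using forest_ext.start by auto
  next
    case (insert e Z)
    then obtain F where "forest_ext G X (X \<union> Z) F" by auto
    then show ?case
      using forest_ext.closed[of G X "X \<union> Z" F e] forest_ext.bridge[of G X "X \<union> Z" F e]
      by (cases "e \<in> X \<union> Z") (auto simp: insert_absorb)
  qed
  from this[of Y] show ?thesis using assms by (simp add: Un_absorb1)
qed

lemma (in fin_digraph) forest_ext_card:
  assumes "forest_ext G X Y F" "Y \<subseteq> arcs G"
  shows "graph_rank G Y = graph_rank G X + card F"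
  using assms
proof (induction rule: forest_ext.induct)
  case (closed Y F e)
  then show ?case by (simp add: graph_rank_insert_conn)
next
  case (bridge Y F e)
  then have "e \<notin> F" "finite F"
    using forest_ext_subset[of G X Y F] finite_subset[of F "arcs G"] by auto
  with bridge show ?case by (simp add: graph_rank_insert_not_conn)
qed simp

text \<open>An edge added by \<open>closed\<close> leaves all classes unchanged, so after
  contraction of \<open>X\<close> the edges in \<open>F\<close> form a spanning forest.\<close>

lemma conn_forest_ext: "forest_ext G X Y F \<Longrightarrow> conn G (X \<union> F) = conn G Y"
proof (induction rule: forest_ext.induct)
  case (closed Y F e)
  then show ?case by (simp add: conn_insert_conn)
next
  case (bridge Y F e)
  then show ?case by (simp add: conn_insert)
qed simp

section \<open>Coordinates for tensions and flows\<close>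

text \<open>
  For a subgroup \<open>H\<close>, restriction to \<open>B\<close> is a bijection from \<open>H\<close> onto all functions on \<open>B\<close>.
\<close>

definition coords :: "('e \<Rightarrow> 'k::ab_group_add) set \<Rightarrow> 'e set \<Rightarrow> bool" where
  "coords H B \<longleftrightarrow> (\<forall>f\<in>H. (\<forall>e\<in>B. f e = 0) \<longrightarrow> f = 0) \<and> (\<forall>b. \<exists>f\<in>H. \<forall>e\<in>B. f e = b e)"

context fin_digraph
begin

section \<open>Tensions as potential differences\<close>

lemma potential_telescopes:
  assumes "pre_digraph.cas (traversals G) u c v"
    and "\<And>e s. (e, s) \<in> set c \<Longrightarrow> f e = p (head G e) - p (tail G e)"
  shows "(\<Sum>(e, s)\<leftarrow>c. if s then f e else - f e) = (p v - p u :: 'k::ab_group_add)"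
  using assms
proof (induction c arbitrary: u)
  case Nil
  then show ?case by (simp add: pre_digraph.cas.simps)
next
  case (Cons a c)
  obtain e s where a: "a = (e, s)" by fastforce
  have cas: "pre_digraph.cas (traversals G) (head (traversals G) a) c v" "tail (traversals G) a = u"
    using Cons.prems(1) by (simp_all add: pre_digraph.cas.simps)
  have "(\<Sum>(e, s)\<leftarrow>c. if s then f e else - f e) = p v - p (head (traversals G) a)"
    using Cons.IH[OF cas(1)] Cons.prems(2) by auto
  moreover have "f e = p (head G e) - p (tail G e)" using Cons.prems(2)[of e s] a by simp
  ultimately show ?case using cas(2) by (auto simp: a traversals_def)
qed

text \<open>Both arcs over an edge have the same two ends. If the edge of the first arc occurred
  again, the path would return to its starting vertex.\<close>

lemma apath_traversals_distinct:
  assumes "pre_digraph.apath (traversals G) u c v"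
  shows "distinct (map fst c)"
proof -
  interpret T: wf_digraph "traversals G"
    by unfold_locales (auto simp: traversals_def)
  show ?thesis using assms
  proof (induction c arbitrary: u)
    case (Cons a c)
    have a: "tail (traversals G) a = u" and path: "T.apath (head (traversals G) a) c v"
      and notin: "u \<notin> set (T.awalk_verts (head (traversals G) a) c)"
      using Cons.prems by (auto simp: T.apath_Cons_iff)
    have cas: "T.cas (head (traversals G) a) c v"
      using path by (auto simp: T.apath_def)
    have "fst b \<noteq> fst a" if "b \<in> set c" for b
    proof
      assume eq: "fst b = fst a"
      have "tail (traversals G) b \<in> set (T.awalk_verts (head (traversals G) a) c)"
        using that by (auto simp: T.awalk_verts_conv)
      moreover have "head (traversals G) b \<in> set (T.awalk_verts (head (traversals G) a) c)"
        using that by (auto simp: T.awalk_verts_conv'[OF cas])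
      moreover have "u \<in> {tail (traversals G) b, head (traversals G) b}"
        using a eq by (cases a; cases b) (auto simp: traversals_def split: if_splits)
      ultimately show False using notin by auto
    qed
    then show ?case using Cons.IH[OF path] by force
  qed simp
qed

text \<open>The path is chosen simple, because a circuit may not repeat vertices, and inside
  \<open>X\<close>, so that an edge outside \<open>X\<close> can close it to a circuit.\<close>

lemma conn_traversal:
  assumes "X \<subseteq> arcs G" "(u, v) \<in> conn G X" "u \<in> verts G"
  obtains c where "pre_digraph.apath (traversals G) u c v" "fst ` set c \<subseteq> X"
proof -
  let ?H = "traversals (G\<lparr>arcs := X\<rparr>)"
  interpret T: wf_digraph "traversals G"
    by unfold_locales (auto simp: traversals_def)
  interpret H: wf_digraph ?H
    by unfold_locales (use assms(1) in \<open>auto simp: traversals_def\<close>)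
  have "u \<rightarrow>\<^sup>*\<^bsub>?H\<^esub> v"
    using assms(2)
  proof (induction rule: conn_induct)
    case refl
    have "u \<in> verts ?H" using assms(3) by (simp add: traversals_def)
    then show ?case by (rule H.reachable_refl)
  next
    case (fwd e)
    have "tail G e \<rightarrow>\<^bsub>?H\<^esub> head G e"
      using fwd(1) unfolding arcs_ends_conv by (intro image_eqI[of _ _ "(e, True)"]) (auto simp: traversals_def)
    then show ?case using fwd by (auto intro: H.reachable_adj_trans)
  next
    case (bwd e)
    have "head G e \<rightarrow>\<^bsub>?H\<^esub> tail G e"
      using bwd(1) unfolding arcs_ends_conv by (intro image_eqI[of _ _ "(e, False)"]) (auto simp: traversals_def)
    then show ?case using bwd by (auto intro: H.reachable_adj_trans)
  qed
  then obtain c where c: "H.apath u c v" by (auto simp: H.reachable_apath)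
  have sub: "subgraph ?H (traversals G)"
    using assms(1) H.wf_digraph T.wf_digraph
    by (intro subgraphI) (auto simp: traversals_def compatible_def)
  have "T.apath u c v"
    using T.subgraph_apath_imp_apath[OF c sub] .
  moreover have "fst ` set c \<subseteq> X"
    using c unfolding H.apath_def H.awalk_def by (auto simp: traversals_def)
  ultimately show thesis using that by blast
qed

text \<open>Around a closed walk potential differences telescope to zero. Conversely, a potential is
  extended edge by edge: an edge within a class closes a circuit, whose condition forces the right
  value; an edge between two classes leaves the freedom to shift the potential on one side.\<close>

lemma tensions_potential:
  fixes f :: "'b \<Rightarrow> 'k::ab_group_add"
  shows "f \<in> tensions G \<longleftrightarrow> (\<forall>e. e \<notin> arcs G \<longrightarrow> f e = 0)
    \<and> (\<exists>p. \<forall>e\<in>arcs G. f e = p (head G e) - p (tail G e))"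
proof
  assume f: "f \<in> tensions G"
  have "\<exists>p. \<forall>e\<in>Y. f e = p (head G e) - p (tail G e)" if "finite Y" "Y \<subseteq> arcs G" for Y
    using that
  proof (induction Y)
    case (insert e Y)
    then obtain p where p: "\<And>d. d \<in> Y \<Longrightarrow> f d = p (head G d) - p (tail G d)" by auto
    show ?case
    proof (cases "(tail G e, head G e) \<in> conn G Y")
      case True
      interpret T: wf_digraph "traversals G"
        by unfold_locales (auto simp: traversals_def)
      \<comment> \<open>\<open>c\<close> leads back from head to tail, so
        \<open>(e, True) # c\<close> is closed; for a loop \<open>c\<close> is empty.\<close>
      obtain c where c: "T.apath (head G e) c (tail G e)" "fst ` set c \<subseteq> Y"
        using conn_traversal[OF _ conn_sym[OF True]] insert.prems by auto
      have walk: "T.awalk (tail G e) ((e, True) # c) (tail G e)"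
        using c insert.prems by (auto simp: T.awalk_Cons_iff T.apath_def) (auto simp: traversals_def)
      have "distinct (map fst ((e, True) # c))"
        using apath_traversals_distinct[OF c(1)] c(2) insert.hyps(2) by auto
      moreover have "T.awalk_verts (tail G e) ((e, True) # c) = tail G e # T.awalk_verts (head G e) c"
        by simp (simp add: traversals_def)
      then have "T.cycle ((e, True) # c)"
        using walk c(1) by (auto simp: T.cycle_def T.apath_def)
      ultimately have "(\<Sum>(e, s)\<leftarrow>(e, True) # c. if s then f e else - f e) = 0"
        using f by (auto simp: tensions_def directed_circuit_def)
      \<comment> \<open>\<open>p\<close> is a potential on \<open>Y\<close> only, which suffices
        because \<open>c\<close> stays inside \<open>Y\<close>.\<close>
      moreover have "(\<Sum>(e, s)\<leftarrow>c. if s then f e else - f e) = p (tail G e) - p (head G e)"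
        by (rule potential_telescopes) (use c p in \<open>auto simp: T.apath_def T.awalk_def\<close>)
      ultimately have "f e = p (head G e) - p (tail G e)" by (simp add: algebra_simps)
      with p show ?thesis by auto
    next
      case False
      define S where "S = conn G Y `` {head G e}"
      \<comment> \<open>The added constant is the defect of \<open>p\<close> at \<open>e\<close>. No
        edge of \<open>Y\<close> leaves \<open>S\<close>, so earlier differences survive; of the
        ends of \<open>e\<close> only the head lies in \<open>S\<close>.\<close>
      define q where "q v = (if v \<in> S then p v + (f e - (p (head G e) - p (tail G e))) else p v)" for v
      have "tail G d \<in> S \<longleftrightarrow> head G d \<in> S" if "d \<in> Y" for d
        using conn_edge[OF that, of G] by (auto simp: S_def intro: conn_trans conn_sym)
      then have "f d = q (head G d) - q (tail G d)" if "d \<in> Y" for d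
        using p[OF that] that by (auto simp: q_def)
      moreover have "head G e \<in> S" "tail G e \<notin> S"
        using False by (auto simp: S_def dest: conn_sym)
      then have "f e = q (head G e) - q (tail G e)" by (auto simp: q_def)
      ultimately show ?thesis by blast
    qed
  qed simp
  from this[of "arcs G"] f show "(\<forall>e. e \<notin> arcs G \<longrightarrow> f e = 0)
    \<and> (\<exists>p. \<forall>e\<in>arcs G. f e = p (head G e) - p (tail G e))"
    by (simp add: tensions_def)
next
  assume "(\<forall>e. e \<notin> arcs G \<longrightarrow> f e = 0) \<and> (\<exists>p. \<forall>e\<in>arcs G. f e = p (head G e) - p (tail G e))"
  then obtain p where supp: "\<And>e. e \<notin> arcs G \<Longrightarrow> f e = 0"
    and p: "\<And>e. e \<in> arcs G \<Longrightarrow> f e = p (head G e) - p (tail G e)" by auto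
  show "f \<in> tensions G"
    unfolding tensions_def
  proof (safe, fact supp)
    fix c assume "directed_circuit G c"
    then obtain u where "pre_digraph.awalk (traversals G) u c u"
      by (auto simp: directed_circuit_def pre_digraph.cycle_def)
    then have "pre_digraph.cas (traversals G) u c u" "set c \<subseteq> arcs (traversals G)"
      by (auto simp: pre_digraph.awalk_def)
    then have "(\<Sum>(e, s)\<leftarrow>c. if s then f e else - f e) = p u - p u"
      by (intro potential_telescopes p) (auto simp: traversals_def)
    then show "(\<Sum>(e, s)\<leftarrow>c. if s then f e else - f e) = 0" by simp
  qed
qed

text \<open>If a tension vanishes on \<open>X\<close> and \<open>F\<close>, its potential is
  constant on the classes of \<open>X \<union> F\<close>, which are those of all edges. Conversely,
  prescribed values on \<open>F\<close> are realised one joining edge at a time by shifting the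
  potential on one side.\<close>

lemma coords_tensions:
  assumes "forest_ext G X (arcs G) F"
  shows "coords {f \<in> tensions G. \<forall>e\<in>X. f e = (0::'k::ab_group_add)} F"
  unfolding coords_def
proof (intro conjI ballI impI allI)
  fix f :: "'b \<Rightarrow> 'k"
  assume "f \<in> {f \<in> tensions G. \<forall>e\<in>X. f e = 0}" and F: "\<forall>e\<in>F. f e = 0"
  then obtain p where supp: "\<And>e. e \<notin> arcs G \<Longrightarrow> f e = 0" and X: "\<forall>e\<in>X. f e = 0"
    and p: "\<And>e. e \<in> arcs G \<Longrightarrow> f e = p (head G e) - p (tail G e)"
    by (auto simp: tensions_potential)
  have sub: "X \<union> F \<subseteq> arcs G" using forest_ext_subset[OF assms] by auto
  show "f = 0"
  proof
    fix e show "f e = 0 e"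
    proof (cases "e \<in> arcs G")
      case True
      then have "(tail G e, head G e) \<in> conn G (X \<union> F)"
        using conn_forest_ext[OF assms] conn_edge[OF True, of G] by simp
      then have "p (head G e) = p (tail G e)"
        by (rule conn_const) (use X F p sub in force)
      then show ?thesis using p[OF True] by simp
    qed (simp add: supp)
  qed
next
  fix b :: "'b \<Rightarrow> 'k"
  have "\<exists>p. (\<forall>e\<in>X. p (head G e) = p (tail G e)) \<and> (\<forall>e\<in>F. b e = p (head G e) - p (tail G e))"
    if "forest_ext G X Y F" for Y F
    using that
  proof (induction rule: forest_ext.induct)
    \<comment> \<open>Only joining edges bring a new condition: an edge added by
      \<open>closed\<close> enters neither \<open>X\<close> nor \<open>F\<close>, and its value
      follows from the potential.\<close>
    case (bridge Y F e)
    then obtain p where p: "\<forall>e\<in>X. p (head G e) = p (tail G e)"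
      "\<forall>e\<in>F. b e = p (head G e) - p (tail G e)" by auto
    define S where "S = conn G Y `` {head G e}"
    define q where "q v = (if v \<in> S then p v + (b e - (p (head G e) - p (tail G e))) else p v)" for v
    have "tail G d \<in> S \<longleftrightarrow> head G d \<in> S" if "d \<in> X \<union> F" for d
    proof -
      have "d \<in> Y" using that forest_ext_subset[OF bridge(1)] by auto
      then show ?thesis
        using conn_edge[of d Y G] by (auto simp: S_def intro: conn_trans conn_sym)
    qed
    then have "q (head G d) - q (tail G d) = p (head G d) - p (tail G d)" if "d \<in> X \<union> F" for d
      using that by (auto simp: q_def)
    moreover have "head G e \<in> S" "tail G e \<notin> S"
      using bridge(3) by (auto simp: S_def dest: conn_sym)
    then have "b e = q (head G e) - q (tail G e)" by (auto simp: q_def)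
    ultimately have "(\<forall>e\<in>X. q (head G e) = q (tail G e))
        \<and> (\<forall>e\<in>insert e F. b e = q (head G e) - q (tail G e))"
      using p by (metis Un_iff insert_iff right_minus_eq)
    then show ?case by blast
  qed auto
  from this[OF assms] obtain p where p: "\<And>e. e \<in> X \<Longrightarrow> p (head G e) = p (tail G e)"
    "\<And>e. e \<in> F \<Longrightarrow> b e = p (head G e) - p (tail G e)" by auto
  define f where "f e = (if e \<in> arcs G then p (head G e) - p (tail G e) else 0)" for e
  have "f \<in> tensions G" unfolding tensions_potential by (auto simp: f_def)
  moreover have "\<forall>e\<in>X. f e = 0" "\<forall>e\<in>F. f e = b e"
    using forest_ext_subset[OF assms] p by (auto simp: f_def)
  ultimately show "\<exists>f\<in>{f \<in> tensions G. \<forall>e\<in>X. f e = 0}. \<forall>e\<in>F. f e = b e" by blast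
qed

section \<open>Flows as functions with zero boundary\<close>

definition boundary :: "('b \<Rightarrow> 'k::ab_group_add) \<Rightarrow> 'a \<Rightarrow> 'k" where
  "boundary g v = (\<Sum>e\<in>arcs G. (if tail G e = v then g e else 0) - (if head G e = v then g e else 0))"

text \<open>For a loop the two terms cancel, matching the zero of \<open>incidence\<close>. Outside
  \<open>verts G\<close> no edge ends, so the boundary vanishes there and the flow condition is one
  equation between functions, to which additivity of \<open>boundary\<close> applies.\<close>

lemma flows_boundary:
  "g \<in> flows G \<longleftrightarrow> (\<forall>e. e \<notin> arcs G \<longrightarrow> g e = 0) \<and> boundary g = (0 :: 'a \<Rightarrow> 'k::ab_group_add)"
proof -
  have "sign_mult (incidence G v e) (g e)
      = (if tail G e = v then g e else 0) - (if head G e = v then g e else 0)" for v e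
    by (auto simp: sign_mult_def incidence_def)
  moreover have "boundary g v = 0" if "v \<notin> verts G" for v
    using that unfolding boundary_def by (intro sum.neutral) auto
  ultimately show ?thesis
    by (auto simp: flows_def boundary_def fun_eq_iff)
qed

lemma boundary_zero: "boundary (\<lambda>e. 0) v = 0"
  by (simp add: boundary_def)

lemma boundary_add: "boundary (g + h) = boundary g + boundary h"
  by (auto simp: boundary_def fun_eq_iff simp flip: sum.distrib intro!: sum.cong)

lemma boundary_single:
  assumes "e \<in> arcs G"
  shows "boundary (\<lambda>d. if d = e then a else 0) v
    = (if v = tail G e then a else 0) - (if v = head G e then (a :: 'k::ab_group_add) else 0)"
proof -
  have "boundary (\<lambda>d. if d = e then a else 0) v = (\<Sum>d\<in>arcs G. if d = e then
      (if tail G d = v then a else 0) - (if head G d = v then a else 0) else 0)"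
    unfolding boundary_def by (rule sum.cong) auto
  then show ?thesis using assms by auto
qed

text \<open>The amount \<open>a\<close> is sent along a walk from \<open>u\<close> to
  \<open>v\<close>: each forward step adds \<open>a\<close> on its edge, each backward step
  \<open>- a\<close>, and the contributions at inner vertices cancel.\<close>

lemma boundary_path:
  assumes "Y \<subseteq> arcs G" "(u, v) \<in> conn G Y"
  shows "\<exists>g. (\<forall>e. e \<notin> Y \<longrightarrow> g e = 0) \<and>
    (\<forall>w. boundary g w = (if w = u then a else 0) - (if w = v then (a :: 'k::ab_group_add) else 0))"
  using assms(2)
proof (induction rule: conn_induct)
  case refl
  show ?case by (rule exI[of _ "\<lambda>e. 0"]) (auto simp: boundary_zero)
next
  case (fwd e)
  then obtain g where g: "\<forall>e. e \<notin> Y \<longrightarrow> g e = 0"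
    "\<And>w. boundary g w = (if w = u then a else 0) - (if w = tail G e then a else 0)" by auto
  have e: "e \<in> arcs G" using fwd assms by auto
  have "boundary (g + (\<lambda>d. if d = e then a else 0)) w
      = (if w = u then a else 0) - (if w = head G e then a else 0)" for w
    unfolding boundary_add plus_fun_apply g(2) boundary_single[OF e] by simp
  moreover have "\<forall>d. d \<notin> Y \<longrightarrow> (g + (\<lambda>d. if d = e then a else 0)) d = 0"
    using g(1) fwd(1) by auto
  ultimately show ?case by blast
next
  case (bwd e)
  then obtain g where g: "\<forall>e. e \<notin> Y \<longrightarrow> g e = 0"
    "\<And>w. boundary g w = (if w = u then a else 0) - (if w = head G e then a else 0)" by auto
  have e: "e \<in> arcs G" using bwd assms by auto
  have "boundary (g + (\<lambda>d. if d = e then - a else 0)) w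
      = (if w = u then a else 0) - (if w = tail G e then a else 0)" for w
    unfolding boundary_add plus_fun_apply g(2) boundary_single[OF e] by simp
  moreover have "\<forall>d. d \<notin> Y \<longrightarrow> (g + (\<lambda>d. if d = e then - a else 0)) d = 0"
    using g(1) bwd(1) by auto
  ultimately show ?case by blast
qed

text \<open>A cut has zero net flow; here the cut consists of the single edge \<open>e\<close>.\<close>

lemma flow_bridge_zero:
  assumes "Y \<subseteq> arcs G" "e \<in> arcs G" "(tail G e, head G e) \<notin> conn G Y"
    and g: "g \<in> flows G" "\<And>d. d \<notin> insert e Y \<Longrightarrow> g d = 0"
  shows "g e = (0 :: 'k::ab_group_add)"
proof -
  define S where "S = conn G Y `` {tail G e}"
  have S: "S \<subseteq> verts G" using conn_in_verts[OF assms(1)] assms(2) by (auto simp: S_def)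
  then have fin: "finite S" by (rule finite_subset) simp
  have "0 = (\<Sum>v\<in>S. boundary g v)" using g(1) by (simp add: flows_boundary)
  also have "\<dots> = (\<Sum>d\<in>arcs G. (if tail G d \<in> S then g d else 0) - (if head G d \<in> S then g d else 0))"
    unfolding boundary_def using fin
    by (subst sum.swap) (simp add: sum_subtractf)
  also have "\<dots> = (\<Sum>d\<in>arcs G. if d = e then g e else 0)"
  proof (rule sum.cong)
    fix d assume "d \<in> arcs G"
    have "head G e \<notin> S" "tail G e \<in> S" using assms(3) by (auto simp: S_def)
    moreover have "tail G d \<in> S \<longleftrightarrow> head G d \<in> S" if "d \<in> Y"
      using conn_edge[OF that, of G] by (auto simp: S_def intro: conn_trans conn_sym)
    ultimately show "(if tail G d \<in> S then g d else 0) - (if head G d \<in> S then g d else 0)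
        = (if d = e then g e else 0)"
      using g(2)[of d] by auto
  qed simp
  also have "\<dots> = g e" using assms(2) by simp
  finally show ?thesis by simp
qed

text \<open>Uniqueness: a flow supported on \<open>F\<close> loses its forest edges from the newest
  to the oldest, each being a bridge among the edges present at its turn. Existence: an edge outside
  \<open>F\<close> closes a cycle with earlier edges, and a circulation around it sets the value
  there.\<close>

lemma coords_flows:
  assumes "forest_ext G {} Y F" "Y \<subseteq> arcs G"
  shows "coords {g \<in> flows G. \<forall>e\<in>arcs G - Y. g e = (0::'k::ab_group_add)} (Y - F)"
  unfolding coords_def
proof (intro conjI ballI impI allI)
  fix g :: "'b \<Rightarrow> 'k"
  assume g: "g \<in> {g \<in> flows G. \<forall>e\<in>arcs G - Y. g e = 0}" "\<forall>e\<in>Y - F. g e = 0"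
  have "g = 0" if "\<And>e. e \<notin> F \<Longrightarrow> g e = 0" "g \<in> flows G"
    using assms that
  proof (induction rule: forest_ext.induct)
    case (bridge Y F e)
    have "g e = 0"
      by (rule flow_bridge_zero[of Y]) (use bridge forest_ext_subset[OF bridge(1)] in auto)
    with bridge show ?case by auto metis
  qed auto
  moreover have "g e = 0" if "e \<notin> F" for e
    using g that by (cases "e \<in> arcs G") (auto simp: flows_boundary)
  ultimately show "g = 0" using g by auto
next
  fix b :: "'b \<Rightarrow> 'k"
  have "\<exists>g\<in>flows G. (\<forall>e. e \<notin> Y \<longrightarrow> g e = 0) \<and> (\<forall>e\<in>Y - F. g e = b e)"
    using assms
  proof (induction arbitrary: b rule: forest_ext.induct)
    case start
    show ?case by (rule bexI[of _ "\<lambda>e. 0"]) (auto simp: flows_boundary boundary_zero)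
  next
    case (closed Y F e)
    then have Y: "Y \<subseteq> arcs G" "e \<in> arcs G" by auto
    obtain c where c: "\<forall>d. d \<notin> Y \<longrightarrow> c d = 0" "\<And>w. boundary c w
        = (if w = head G e then b e else 0) - (if w = tail G e then b e else 0)"
      using boundary_path[OF Y(1) conn_sym[OF closed(3)], of "b e"] by blast
    \<comment> \<open>The circulation that carries \<open>b e\<close> through \<open>e\<close> and
      returns from head to tail inside \<open>Y\<close>.\<close>
    define c' where "c' = c + (\<lambda>d. if d = e then b e else 0)"
    \<comment> \<open>The circulation also disturbs the coordinates in \<open>Y - F\<close>; the
      induction hypothesis for \<open>b - c'\<close> compensates this.\<close>
    obtain g where g: "g \<in> flows G" "\<forall>e. e \<notin> Y \<longrightarrow> g e = 0" "\<forall>e\<in>Y - F. g e = b e - c' e"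
      using closed.IH[OF Y(1), of "\<lambda>d. b d - c' d"] by auto
    have bc: "boundary c' = 0"
      by (auto simp: c'_def boundary_add c boundary_single[OF Y(2)] fun_eq_iff)
    have "g + c' \<in> flows G"
      using g c(1) Y unfolding flows_boundary boundary_add bc by (auto simp: c'_def)
    moreover have "\<forall>d. d \<notin> insert e Y \<longrightarrow> (g + c') d = 0"
      using g c(1) by (auto simp: c'_def)
    moreover have "\<forall>d\<in>insert e Y - F. (g + c') d = b d"
      using g c(1) closed(2) by (auto simp: c'_def)
    ultimately show ?case by blast
  next
    case (bridge Y F e)
    have "Y \<subseteq> arcs G" using bridge.prems by simp
    from bridge.IH[OF this, of b] obtain g
      where g: "g \<in> flows G" "\<forall>e. e \<notin> Y \<longrightarrow> g e = 0" "\<forall>e\<in>Y - F. g e = b e" by blast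
    then show ?case using bridge(2) by (intro bexI[of _ g]) auto
  qed
  then show "\<exists>g\<in>{g \<in> flows G. \<forall>e\<in>arcs G - Y. g e = 0}. \<forall>e\<in>Y - F. g e = b e" by auto
qed

end

section \<open>Ranks, torsion and inclusion-exclusion\<close>

lemma module_fscale: "module (fscale :: 'k::comm_ring_1 \<Rightarrow> ('e \<Rightarrow> 'k) \<Rightarrow> 'e \<Rightarrow> 'k)"
  by unfold_locales (auto simp: fscale_def algebra_simps)

lemma submod_iff:
  "submod H \<longleftrightarrow> 0 \<in> H \<and> (\<forall>f\<in>H. \<forall>g\<in>H. f + g \<in> H) \<and> (\<forall>c. \<forall>f\<in>H. fscale c f \<in> H)"
  unfolding submod_def by (auto simp: module.subspace_def[OF module_fscale])

lemma submod_diff: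
  assumes "submod H" "f \<in> H" "g \<in> H"
  shows "f - g \<in> H"
proof -
  have "f + fscale (- 1) g \<in> H" using assms by (auto simp: submod_iff)
  moreover have "f + fscale (- 1) g = f - g" by (auto simp: fscale_def)
  ultimately show ?thesis by simp
qed

lemma sum_fun_apply: "(\<Sum>i\<in>I. f i) x = (\<Sum>i\<in>I. f i x)"
  by (induction I rule: infinite_finite_induct) auto

text \<open>Gaussian elimination without division, so that integer coefficients are covered.\<close>

lemma ex_nontrivial_relation:
  fixes v :: "'i \<Rightarrow> 'e \<Rightarrow> 'k::idom"
  assumes "finite B" "finite I" "card B < card I"
  shows "\<exists>c. (\<exists>i\<in>I. c i \<noteq> 0) \<and> (\<forall>e\<in>B. (\<Sum>i\<in>I. c i * v i e) = 0)"
  using assms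
proof (induction B arbitrary: I v)
  case empty
  then have "I \<noteq> {}" by auto
  then show ?case by (intro exI[of _ "\<lambda>_. 1"]) auto
next
  case (insert e B)
  show ?case
  proof (cases "\<forall>i\<in>I. v i e = 0")
    case True
    obtain c where "\<exists>i\<in>I. c i \<noteq> 0" "\<forall>e\<in>B. (\<Sum>i\<in>I. c i * v i e) = 0"
      using insert.IH[of I v] insert.prems insert.hyps by auto
    then show ?thesis using True by (intro exI[of _ c]) auto
  next
    case False
    then obtain i0 where i0: "i0 \<in> I" "v i0 e \<noteq> 0" by auto
    \<comment> \<open>Cross-multiplication with the pivot \<open>v i0 e\<close> makes coordinate
      \<open>e\<close> of every \<open>w i\<close> zero.\<close>
    define w where "w i d = v i0 e * v i d - v i e * v i0 d" for i d
    have "card B < card (I - {i0})" using insert.prems insert.hyps i0 by simp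
    then obtain c where c: "\<exists>i\<in>I - {i0}. c i \<noteq> 0" "\<forall>d\<in>B. (\<Sum>i\<in>I - {i0}. c i * w i d) = 0"
      using insert.IH[of "I - {i0}" w] insert.prems by auto
    \<comment> \<open>Inserting \<open>w\<close> into the relation \<open>c\<close> and collecting
      the terms in \<open>v i0\<close> gives the coefficient at \<open>i0\<close>. The others are
      multiplied by the pivot, which keeps non-zero ones non-zero in a domain.\<close>
    define c' where "c' i = (if i = i0 then - (\<Sum>j\<in>I - {i0}. c j * v j e) else c i * v i0 e)" for i
    have "(\<Sum>i\<in>I. c' i * v i d) = (\<Sum>i\<in>I - {i0}. c i * w i d)" for d
    proof -
      have "(\<Sum>i\<in>I. c' i * v i d) = c' i0 * v i0 d + (\<Sum>i\<in>I - {i0}. c' i * v i d)"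
        using i0 insert.prems by (subst sum.remove) auto
      also have "(\<Sum>i\<in>I - {i0}. c' i * v i d) = (\<Sum>i\<in>I - {i0}. c i * v i0 e * v i d)"
        by (rule sum.cong) (auto simp: c'_def)
      also have "c' i0 * v i0 d + \<dots> = (\<Sum>i\<in>I - {i0}. c i * w i d)"
      proof -
        have "(\<Sum>i\<in>I - {i0}. c i * w i d)
          = (\<Sum>i\<in>I - {i0}. c i * v i0 e * v i d - c i * v i e * v i0 d)"
          by (rule sum.cong) (simp_all add: w_def algebra_simps)
        then show ?thesis
          by (simp add: c'_def sum_subtractf sum_distrib_right)
      qed
      finally show ?thesis .
    qed
    moreover have "(\<Sum>i\<in>I - {i0}. c i * w i e) = 0"
      by (rule sum.neutral) (auto simp: w_def)
    ultimately have "\<forall>d\<in>insert e B. (\<Sum>i\<in>I. c' i * v i d) = 0" using c(2) by simp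
    moreover have "\<exists>i\<in>I. c' i \<noteq> 0" using c(1) i0 by (auto simp: c'_def)
    ultimately show ?thesis by blast
  qed
qed

text \<open>More than \<open>card B\<close> members of \<open>H\<close> satisfy a relation on the
  coordinates \<open>B\<close>, and the combination, lying in \<open>H\<close>, is then zero.
  Members of \<open>H\<close> that restrict to unit vectors on \<open>B\<close> attain the
  bound.\<close>

lemma mod_rank_coords:
  fixes H :: "('e \<Rightarrow> 'k::idom) set"
  assumes H: "submod H" and B: "finite B" "coords H B"
  shows "mod_rank H = card B"
proof -
  note dep = module.dependent_explicit[OF module_fscale]
  have le: "card S \<le> card B" if S: "S \<subseteq> H" "finite S" "\<not> module.dependent fscale S" for S
  proof (rule ccontr)
    assume "\<not> card S \<le> card B"
    then obtain c where c: "\<exists>f\<in>S. c f \<noteq> 0" "\<forall>e\<in>B. (\<Sum>f\<in>S. c f * f e) = 0"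
      using ex_nontrivial_relation[of B S "\<lambda>f. f"] B S by auto
    define h where "h = (\<Sum>f\<in>S. fscale (c f) f)"
    have "h \<in> H" unfolding h_def
      using H S(1) by (auto simp: submod_def intro!: module.subspace_sum[OF module_fscale]
          module.subspace_scale[OF module_fscale])
    moreover have "\<forall>e\<in>B. h e = 0"
      using c(2) by (simp add: h_def sum_fun_apply fscale_def)
    ultimately have "h = 0" using B by (auto simp: coords_def)
    then show False using S c(1) by (auto simp: dep h_def)
  qed
  obtain w where w: "\<And>b. w b \<in> H" "\<And>b e. e \<in> B \<Longrightarrow> w b e = (if e = b then 1 else 0)"
  proof -
    have "\<exists>f\<in>H. \<forall>e\<in>B. f e = (if e = b then 1 else 0)" for b
      using B(2) unfolding coords_def by (elim conjE allE)
    then show thesis using that by metis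
  qed
  have inj: "inj_on w B"
    by (rule inj_onI) (metis w(2) zero_neq_one)
  have "\<not> module.dependent fscale (w ` B)"
  proof
    assume "module.dependent fscale (w ` B)"
    then obtain t u g where t: "finite t" "t \<subseteq> w ` B" "(\<Sum>f\<in>t. fscale (u f) f) = 0"
      and g: "g \<in> t" "u g \<noteq> 0" by (auto simp: dep)
    then obtain b where b: "b \<in> B" "w b \<in> t" "u (w b) \<noteq> 0" by blast
    have "0 = (\<Sum>f\<in>t. u f * f b)"
      using arg_cong[OF t(3), of "\<lambda>f. f b"] by (simp add: sum_fun_apply fscale_def)
    also have "\<dots> = (\<Sum>f\<in>t. if f = w b then u f else 0)"
      by (rule sum.cong) (use t(2) b(1) inj in \<open>auto simp: w(2) inj_on_eq_iff\<close>)
    finally show False using t(1) b by simp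
  qed
  then have mem: "card B \<in> {card S |S. S \<subseteq> H \<and> finite S \<and> \<not> module.dependent fscale S}"
    using w(1) B(1) inj by (intro CollectI exI[of _ "w ` B"]) (auto simp: card_image)
  \<comment> \<open>\<open>Max\<close> is meaningful only on a finite set; the bound
    \<open>le\<close> provides finiteness.\<close>
  have "finite {card S |S. S \<subseteq> H \<and> finite S \<and> \<not> module.dependent fscale S}"
    by (rule finite_subset[of _ "{..card B}"]) (use le in auto)
  then show ?thesis
    unfolding mod_rank_def by (rule Max_eqI) (use le mem in auto)
qed

lemma card_coords:
  fixes H :: "('e \<Rightarrow> 'a::{finite, ab_group_add}) set"
  assumes diff: "\<And>f g. f \<in> H \<Longrightarrow> g \<in> H \<Longrightarrow> f - g \<in> H" and B: "finite B" "coords H B"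
  shows "card H = CARD('a) ^ card B"
proof -
  have "bij_betw (\<lambda>f. restrict f B) H (B \<rightarrow>\<^sub>E UNIV)"
    unfolding bij_betw_def
  proof (intro conjI equalityI subsetI inj_onI)
    fix f g assume fg: "f \<in> H" "g \<in> H" "restrict f B = restrict g B"
    then have "\<forall>e\<in>B. (f - g) e = 0" by (metis fun_diff_def restrict_apply' right_minus_eq)
    then have "f - g = 0" using diff[OF fg(1,2)] B(2) unfolding coords_def by blast
    then show "f = g" by simp
  next
    fix b :: "'e \<Rightarrow> 'a" assume b: "b \<in> B \<rightarrow>\<^sub>E UNIV"
    obtain f where "f \<in> H" "\<forall>e\<in>B. f e = b e" using B(2) unfolding coords_def by blast
    with b have "restrict f B = b" by (auto simp: fun_eq_iff PiE_def extensional_def)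
    then show "b \<in> (\<lambda>f. restrict f B) ` H" using \<open>f \<in> H\<close> by blast
  qed auto
  then have "card H = card (B \<rightarrow>\<^sub>E (UNIV :: 'a set))" by (rule bij_betw_same_card)
  then show ?thesis using B(1) by (simp add: card_PiE)
qed

section \<open>Torsion of submodules and quotients\<close>

lemma comm_group_add_monoid_on:
  assumes "submod M"
  shows "comm_group (add_monoid_on M)"
proof (rule comm_groupI)
  fix x assume "x \<in> carrier (add_monoid_on M)"
  then have "0 - x \<in> M" using submod_diff[OF assms, of 0 x] assms
    by (auto simp: add_monoid_on_def submod_iff)
  then show "\<exists>y\<in>carrier (add_monoid_on M). y \<otimes>\<^bsub>add_monoid_on M\<^esub> x = \<one>\<^bsub>add_monoid_on M\<^esub>"
    by (intro bexI[of _ "0 - x"]) (auto simp: add_monoid_on_def)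
qed (use assms in \<open>auto simp: add_monoid_on_def submod_iff add_ac\<close>)

lemma add_monoid_on_pow:
  "a [^]\<^bsub>add_monoid_on M\<^esub> (n::nat) = fscale (of_nat n) (a :: 'e \<Rightarrow> 'k::comm_ring_1)"
  by (induction n) (auto simp: nat_pow_def add_monoid_on_def fscale_def algebra_simps)

lemma Tor_add_monoid_on:
  fixes M :: "('e \<Rightarrow> 'k::{idom, ring_char_0}) set"
  assumes "submod M"
  shows "Tor (add_monoid_on M) = {0}"
  using assms
  by (auto simp: Tor_def add_monoid_on_pow fscale_def fun_eq_iff submod_iff)
    (auto simp: add_monoid_on_def fun_eq_iff)

text \<open>The coset of \<open>a\<close> is torsion when a positive multiple of \<open>a\<close>
  lies in \<open>H\<close>; saturation then puts \<open>a\<close> itself in \<open>H\<close>. The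
  neutral element of the quotient is the set \<open>H\<close>.\<close>

lemma Tor_add_monoid_on_Mod:
  fixes M H :: "('e \<Rightarrow> 'k::comm_ring_1) set"
  assumes "submod M" "submod H" "H \<subseteq> M"
    and saturated: "\<And>n a. n > 0 \<Longrightarrow> a \<in> M \<Longrightarrow> fscale (of_nat n) a \<in> H \<Longrightarrow> a \<in> H"
  shows "Tor (add_monoid_on M Mod H) = {H}"
proof -
  interpret M: comm_group "add_monoid_on M" by (rule comm_group_add_monoid_on) fact
  have sub: "subgroup H (add_monoid_on M)"
  proof (rule M.subgroupI)
    fix a assume "a \<in> H"
    then have "0 - a \<in> H" using submod_diff[OF assms(2), of 0 a] assms(2) by (auto simp: submod_iff)
    moreover have "inv\<^bsub>add_monoid_on M\<^esub> a = 0 - a"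
      by (rule M.inv_equality) (use \<open>a \<in> H\<close> calculation assms(3) in \<open>auto simp: add_monoid_on_def\<close>)
    ultimately show "inv\<^bsub>add_monoid_on M\<^esub> a \<in> H" by simp
  qed (use assms in \<open>auto simp: add_monoid_on_def submod_iff\<close>)
  interpret N: normal H "add_monoid_on M" using M.subgroup_imp_normal[OF sub] .
  show ?thesis
  proof (intro equalityI subsetI)
    fix C assume "C \<in> Tor (add_monoid_on M Mod H)"
    then obtain n :: nat and a where n: "n > 0" "C [^]\<^bsub>add_monoid_on M Mod H\<^esub> n = H"
      and a: "a \<in> M" "C = H #>\<^bsub>add_monoid_on M\<^esub> a"
      by (auto simp: Tor_def FactGroup_def RCOSETS_def add_monoid_on_def)
    have aM: "a \<in> carrier (add_monoid_on M)" using a by (simp add: add_monoid_on_def)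
    have eq: "H #>\<^bsub>add_monoid_on M\<^esub> (a [^]\<^bsub>add_monoid_on M\<^esub> n) = H"
      using n(2) N.FactGroup_pow[OF aM, of n] by (simp add: a(2))
    have "a [^]\<^bsub>add_monoid_on M\<^esub> n \<in> H"
      by (rule M.coset_join1[OF eq _ sub]) (use aM in simp)
    then have "a \<in> H" using saturated n(1) a(1) by (simp add: add_monoid_on_pow)
    then show "C \<in> {H}" using M.coset_join2[OF aM sub] a(2) by simp
  next
    fix C assume C: "C \<in> {H}"
    have eq: "H #>\<^bsub>add_monoid_on M\<^esub> \<one>\<^bsub>add_monoid_on M\<^esub> = H"
      by (rule M.coset_join2[OF _ sub]) (simp_all add: subgroup.one_closed[OF sub])
    then have "H \<in> carrier (add_monoid_on M Mod H)"
      unfolding FactGroup_def RCOSETS_def by (auto intro!: bexI[OF _ M.one_closed])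
    moreover have "H [^]\<^bsub>add_monoid_on M Mod H\<^esub> (1::nat) = H"
      using N.FactGroup_pow[OF M.one_closed, of 1] unfolding M.nat_pow_one eq .
    then have "H [^]\<^bsub>add_monoid_on M Mod H\<^esub> (1::nat) = \<one>\<^bsub>add_monoid_on M Mod H\<^esub>"
      unfolding FactGroup_def by simp
    ultimately show "C \<in> Tor (add_monoid_on M Mod H)"
      using C zero_less_one unfolding Tor_def by blast
  qed
qed

text \<open>
  The hypothesis on \<open>\<nu>\<close> is the recursion in the first argument; \<open>moebius\<close> is defined by the one in
  the second.
\<close>

lemma moebius_eqI:
  fixes P :: "'p::order set" and \<nu> :: "'p \<Rightarrow> int"
  assumes P: "finite P" "t \<in> P" "x \<in> P" "\<And>y. y \<in> P \<Longrightarrow> y \<le> t"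
    and \<nu>: "\<And>y. y \<in> P \<Longrightarrow> (\<Sum>z\<in>{z \<in> P. y \<le> z}. \<nu> z) = (if y = t then 1 else 0)"
  shows "moebius P x t = \<nu> x"
proof -
  have left: "(\<Sum>y\<in>{y \<in> P. x \<le> y \<and> y \<le> z}. moebius P x y) = (if z = x then 1 else 0)"
    if "z \<in> P" for z
  proof (cases "x \<le> z \<and> x \<noteq> z")
    case True
    have "{y \<in> P. x \<le> y \<and> y \<le> z} = insert z {y \<in> P. x \<le> y \<and> y < z}"
      using True that by auto
    then have "(\<Sum>y\<in>{y \<in> P. x \<le> y \<and> y \<le> z}. moebius P x y)
        = moebius P x z + (\<Sum>y\<in>{y \<in> P. x \<le> y \<and> y < z}. moebius P x y)"
      using P(1) by simp
    then show ?thesis using True that P(1,3) by (auto simp: moebius.simps[of P x z])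
  next
    case False
    then have "{y \<in> P. x \<le> y \<and> y \<le> z} = (if z = x then {x} else {})"
      using that by auto
    then show ?thesis using P by (auto simp: moebius.simps[of P x x])
  qed
  have "moebius P x t = (\<Sum>y\<in>{y \<in> P. x \<le> y}. moebius P x y * (if y = t then 1 else 0))"
  proof -
    have "(\<Sum>y\<in>{y \<in> P. x \<le> y}. moebius P x y * (if y = t then 1 else 0))
        = (\<Sum>y\<in>{y \<in> P. x \<le> y}. if y = t then moebius P x y else 0)"
      by (rule sum.cong) auto
    also have "\<dots> = moebius P x t"
      using P(1,2) P(4)[OF P(3)] by (subst sum.delta) auto
    finally show ?thesis by simp
  qed
  \<comment> \<open>A left inverse of the zeta function equals a right inverse: in this double sum
    over \<open>y \<le> z\<close>, summation over \<open>z\<close> first isolates \<open>t\<close>,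
    summation over \<open>y\<close> first isolates \<open>x\<close>.\<close>
  also have "\<dots> = (\<Sum>y\<in>{y \<in> P. x \<le> y}. \<Sum>z\<in>{z \<in> P. y \<le> z}. moebius P x y * \<nu> z)"
    by (rule sum.cong) (auto simp: \<nu> simp flip: sum_distrib_left)
  also have "\<dots> = (\<Sum>z\<in>P. \<Sum>y\<in>{y \<in> P. x \<le> y \<and> y \<le> z}. moebius P x y * \<nu> z)"
    using P(1) by (simp add: sum.Sigma)
      (rule sum.reindex_bij_witness[of _ "\<lambda>(z, y). (y, z)" "\<lambda>(y, z). (z, y)"], auto)
  also have "\<dots> = (\<Sum>z\<in>P. if z = x then \<nu> z else 0)"
    by (rule sum.cong) (auto simp: left simp flip: sum_distrib_right)
  also have "\<dots> = \<nu> x" using P(1,3) by simp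
  finally show ?thesis .
qed

lemma sum_Pow_insert:
  assumes "finite F" "e \<notin> F"
  shows "(\<Sum>S\<in>Pow (insert e F). g S) = (\<Sum>S\<in>Pow F. g S) + (\<Sum>S\<in>Pow F. g (insert e S))"
proof -
  have inj: "inj_on (insert e) (Pow F)" using assms(2) by (auto simp: inj_on_def)
  have "(\<Sum>S\<in>Pow (insert e F). g S) = (\<Sum>S\<in>Pow F. g S) + (\<Sum>S\<in>insert e ` Pow F. g S)"
    unfolding Pow_insert using assms by (intro sum.union_disjoint) auto
  then show ?thesis by (simp add: sum.reindex[OF inj])
qed

lemma sum_Pow_alternating:
  assumes "finite A"
  shows "(\<Sum>S\<in>Pow A. (- 1) ^ card S) = (if A = {} then 1 else 0 :: 'r::comm_ring_1)"
proof (cases "A = {}")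
  case False
  then obtain e F where A: "A = insert e F" "e \<notin> F" by (meson mk_disjoint_insert all_not_in_conv)
  with assms have fin: "finite F" by simp
  have "(\<Sum>S\<in>Pow F. (- 1) ^ card (insert e S)) = - (\<Sum>S\<in>Pow F. (- 1 :: 'r) ^ card S)"
    unfolding sum_negf[symmetric]
    by (rule sum.cong) (use fin A in \<open>auto simp: card_insert_if finite_subset\<close>)
  then show ?thesis using A fin by (simp add: sum_Pow_insert)
qed simp

text \<open>Removing \<open>A e\<close> from \<open>?W\<close> subtracts the value of
  \<open>?W \<inter> A e\<close>, which has the same shape with \<open>U \<inter> A e\<close> for
  \<open>U\<close>; hence the induction over all \<open>U\<close>. Family and value ring stay
  general to cover both cardinalities and the coset valuation.\<close>

lemma valuation_inclusion_exclusion: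
  assumes v: "valuation_on \<R> v"
    and \<R>: "\<And>S S'. S \<in> \<R> \<Longrightarrow> S' \<in> \<R> \<Longrightarrow> S \<inter> S' \<in> \<R>"
      "\<And>S S'. S \<in> \<R> \<Longrightarrow> S' \<in> \<R> \<Longrightarrow> S - S' \<in> \<R>"
    and "finite F" "U \<in> \<R>" "\<And>e. e \<in> F \<Longrightarrow> A e \<in> \<R>"
  shows "v (U - (\<Union>e\<in>F. A e)) = (\<Sum>S\<in>Pow F. (- 1) ^ card S * v (U \<inter> (\<Inter>e\<in>S. A e)))"
  using assms(4-6)
proof (induction F arbitrary: U)
  case (insert e F)
  let ?W = "U - (\<Union>e\<in>F. A e)"
  have diff_Union: "U - (\<Union>e\<in>F. A e) \<in> \<R>" if "U \<in> \<R>" for U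
    using insert.hyps(1) insert.prems(2) that
  proof (induction F arbitrary: U)
    case (insert d F)
    have "U - (\<Union>e\<in>insert d F. A e) = (U - A d) - (\<Union>e\<in>F. A e)" by auto
    moreover have "U - A d \<in> \<R>" using insert.prems \<R>(2) by auto
    ultimately show ?case using insert.IH[of "U - A d"] insert.prems by (simp only:) auto
  qed simp
  have W: "?W \<in> \<R>" by (rule diff_Union[OF insert.prems(1)])
  have Ae: "A e \<in> \<R>" "\<And>d. d \<in> F \<Longrightarrow> A d \<in> \<R>" using insert.prems(2) by simp_all
  have "v ?W = v ((?W - A e) \<union> (?W \<inter> A e))" by (rule arg_cong[of _ _ v]) auto
  also have "\<dots> = v (?W - A e) + v (?W \<inter> A e) - v ((?W - A e) \<inter> (?W \<inter> A e))"
    using v \<R>(1)[OF W Ae(1)] \<R>(2)[OF W Ae(1)] by (simp only: valuation_on_def)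
  also have "(?W - A e) \<inter> (?W \<inter> A e) = {}" by auto
  finally have "v (?W - A e) = v ?W - v (?W \<inter> A e)"
    using v by (simp add: valuation_on_def)
  moreover have "?W \<inter> A e = (U \<inter> A e) - (\<Union>e\<in>F. A e)" by auto
  moreover have "v ?W = (\<Sum>S\<in>Pow F. (- 1) ^ card S * v (U \<inter> (\<Inter>e\<in>S. A e)))"
    by (rule insert.IH[OF insert.prems(1) Ae(2)])
  moreover have "v ((U \<inter> A e) - (\<Union>e\<in>F. A e))
      = (\<Sum>S\<in>Pow F. (- 1) ^ card S * v ((U \<inter> A e) \<inter> (\<Inter>e\<in>S. A e)))"
    by (rule insert.IH[OF \<R>(1)[OF insert.prems(1) Ae(1)] Ae(2)])
  moreover have "(\<Sum>S\<in>Pow F. (- 1) ^ card (insert e S) * v (U \<inter> (\<Inter>d\<in>insert e S. A d)))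
      = - (\<Sum>S\<in>Pow F. (- 1) ^ card S * v ((U \<inter> A e) \<inter> (\<Inter>e\<in>S. A e)))"
    unfolding sum_negf[symmetric]
    by (rule sum.cong)
      (use insert.hyps in \<open>auto simp: card_insert_if finite_subset Int_assoc\<close>)
  moreover have "U - (\<Union>e\<in>insert e F. A e) = ?W - A e" by auto
  ultimately show ?case using insert.hyps by (simp add: sum_Pow_insert)
qed simp

lemma eval2_sum: "eval2 (\<Sum>i\<in>I. f i) a b = (\<Sum>i\<in>I. eval2 (f i) a b)"
  by (simp add: eval2_def poly_sum)

lemma eval2_monomial: "eval2 ((- 1) ^ k * var_x ^ i * var_y ^ j) a b = (- 1) ^ k * a ^ i * b ^ j"
  by (simp add: eval2_def var_x_def var_y_def)

section \<open>The tension-flow arrangement\<close>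

context fin_digraph
begin

definition tensions_off :: "'b set \<Rightarrow> ('b \<Rightarrow> 'k::ab_group_add) set" where
  "tensions_off X = {f \<in> tensions G. \<forall>e\<in>X. f e = 0}"

definition flows_off :: "'b set \<Rightarrow> ('b \<Rightarrow> 'k::ab_group_add) set" where
  "flows_off X = {g \<in> flows G. \<forall>e\<in>X. g e = 0}"

lemma tensions_off_empty: "tensions_off {} = tensions G"
  by (simp add: tensions_off_def)

lemma flows_off_empty: "flows_off {} = flows G"
  by (simp add: flows_off_def)

lemma ex_coords_tensions_off:
  assumes "X \<subseteq> arcs G"
  obtains B where "finite B" "card B = graph_rank G (arcs G) - graph_rank G X"
    "coords (tensions_off X :: ('b \<Rightarrow> 'k::ab_group_add) set) B"
proof -
  obtain F where F: "forest_ext G X (arcs G) F"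
    using ex_forest_ext[OF _ assms] by auto
  have "finite F" using forest_ext_subset[OF F] by (auto intro: finite_subset)
  then show thesis
    using that[of F] forest_ext_card[OF F] coords_tensions[OF F] unfolding tensions_off_def by auto
qed

lemma ex_coords_flows_off:
  assumes "X \<subseteq> arcs G"
  obtains B where "finite B" "card B = graph_nullity G (arcs G - X)"
    "coords (flows_off X :: ('b \<Rightarrow> 'k::ab_group_add) set) B"
proof -
  obtain F where F: "forest_ext G {} (arcs G - X) F"
    using ex_forest_ext[of "arcs G - X" "{}"] by auto
  have sub: "F \<subseteq> arcs G - X" "finite F"
    using forest_ext_subset[OF F] by (auto intro: finite_subset)
  have "arcs G - (arcs G - X) = X" using assms by auto
  then have "coords (flows_off X :: ('b \<Rightarrow> 'k) set) (arcs G - X - F)"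
    using coords_flows[OF F] by (simp add: flows_off_def)
  moreover have "card (arcs G - X - F) = graph_nullity G (arcs G - X)"
    using forest_ext_card[OF F] sub by (simp add: graph_nullity_def graph_rank_empty card_Diff_subset)
  ultimately show thesis using that[of "arcs G - X - F"] by simp
qed

text \<open>Separate from \<open>submod_tensions_off\<close>, because the finite coefficient groups
  need not carry a ring structure.\<close>

lemma tensions_off_diff: "f \<in> tensions_off X \<Longrightarrow> g \<in> tensions_off X \<Longrightarrow> f - g \<in> tensions_off X"
proof -
  assume "f \<in> tensions_off X" "g \<in> tensions_off X"
  then obtain p q where "\<forall>e. e \<notin> arcs G \<longrightarrow> f e = 0" "\<forall>e. e \<notin> arcs G \<longrightarrow> g e = 0"
    "\<forall>e\<in>X. f e = 0" "\<forall>e\<in>X. g e = 0"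
    "\<forall>e\<in>arcs G. f e = p (head G e) - p (tail G e)" "\<forall>e\<in>arcs G. g e = q (head G e) - q (tail G e)"
    by (auto simp: tensions_off_def tensions_potential)
  then show "f - g \<in> tensions_off X"
    by (auto simp: tensions_off_def tensions_potential algebra_simps
        intro!: exI[of _ "\<lambda>v. p v - q v"])
qed

lemma boundary_diff: "boundary (f - g) = boundary f - boundary g"
  by (auto simp: boundary_def fun_eq_iff simp flip: sum_subtractf intro!: sum.cong)

lemma flows_off_diff: "f \<in> flows_off X \<Longrightarrow> g \<in> flows_off X \<Longrightarrow> f - g \<in> flows_off X"
  by (auto simp: flows_off_def flows_boundary boundary_diff)

lemma submod_tensions_off: "submod (tensions_off X :: ('b \<Rightarrow> 'k::comm_ring_1) set)"
  unfolding submod_iff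
proof (intro conjI ballI allI)
  show "0 \<in> (tensions_off X :: ('b \<Rightarrow> 'k) set)"
    by (auto simp: tensions_off_def tensions_potential intro!: exI[of _ "\<lambda>v. 0"])
next
  fix f g :: "'b \<Rightarrow> 'k"
  assume "f \<in> tensions_off X" "g \<in> tensions_off X"
  then obtain p q where "\<forall>e. e \<notin> arcs G \<longrightarrow> f e = 0" "\<forall>e. e \<notin> arcs G \<longrightarrow> g e = 0"
    "\<forall>e\<in>X. f e = 0" "\<forall>e\<in>X. g e = 0"
    "\<forall>e\<in>arcs G. f e = p (head G e) - p (tail G e)" "\<forall>e\<in>arcs G. g e = q (head G e) - q (tail G e)"
    by (auto simp: tensions_off_def tensions_potential)
  then show "f + g \<in> tensions_off X"
    by (auto simp: tensions_off_def tensions_potential add_diff_add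
        intro!: exI[of _ "\<lambda>v. p v + q v"])
next
  fix c and f :: "'b \<Rightarrow> 'k"
  assume "f \<in> tensions_off X"
  then obtain p where "\<forall>e. e \<notin> arcs G \<longrightarrow> f e = 0" "\<forall>e\<in>X. f e = 0"
    "\<forall>e\<in>arcs G. f e = p (head G e) - p (tail G e)"
    by (auto simp: tensions_off_def tensions_potential)
  then show "fscale c f \<in> tensions_off X"
    by (auto simp: tensions_off_def tensions_potential fscale_def right_diff_distrib
        intro!: exI[of _ "\<lambda>v. c * p v"])
qed

lemma submod_flows_off: "submod (flows_off X :: ('b \<Rightarrow> 'k::comm_ring_1) set)"
proof -
  have "boundary (fscale c g) v = c * boundary g v" for c :: 'k and g v
    by (auto simp: boundary_def fscale_def sum_distrib_left right_diff_distrib intro!: sum.cong)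
  then have "boundary (fscale c g) = 0" if "boundary g = 0" for c :: 'k and g
    using that by (simp add: fun_eq_iff)
  moreover have "boundary (0 :: 'b \<Rightarrow> 'k) = 0"
    using boundary_zero by (auto simp: fun_eq_iff zero_fun_def)
  ultimately show ?thesis
    by (auto simp: submod_iff flows_off_def flows_boundary boundary_add) (auto simp: fscale_def)
qed

lemma Omega_edge_Inter:
  "Omega G \<inter> (\<Inter>e\<in>X. Omega_edge G e) = tensions_off X \<times> flows_off X"
  by (auto simp: Omega_def Omega_edge_def tensions_off_def flows_off_def)

text \<open>Vanishing on \<open>X\<close> is a saturated condition over a domain of characteristic
  zero, so both torsion subgroups are trivial and only the power of \<open>z\<close> remains. The
  family \<open>M\<close> stands for tensions and for flows.\<close>

lemma coset_weight_off:
  fixes M :: "'b set \<Rightarrow> ('b \<Rightarrow> 'k::{idom, ring_char_0}) set"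
  assumes sub: "submod (M {})" "submod (M X)" and M: "\<And>X. M X = {f \<in> M {}. \<forall>e\<in>X. f e = 0}"
    and B: "finite B" "coords (M X) B"
  shows "coset_weight (M {}) (M X) z = z ^ card B"
proof -
  have "Tor (add_monoid_on (M {}) Mod M X) = {M X}"
  proof (rule Tor_add_monoid_on_Mod[OF sub])
    fix n :: nat and a
    assume "n > 0" "a \<in> M {}" "fscale (of_nat n) a \<in> M X"
    then show "a \<in> M X" by (subst (asm) M, subst M) (auto simp: fscale_def)
  qed (subst M, auto)
  then show ?thesis
    using Tor_add_monoid_on[OF sub(1)] mod_rank_coords[OF sub(2) B]
    by (simp add: coset_weight_def one_pCons[symmetric])
qed

lemma coset_weight_tensions_off:
  assumes "X \<subseteq> arcs G"
  shows "coset_weight (tensions G) (tensions_off X :: ('b \<Rightarrow> 'k::{idom, ring_char_0}) set) z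
    = z ^ (graph_rank G (arcs G) - graph_rank G X)"
proof -
  obtain B where "finite B" "card B = graph_rank G (arcs G) - graph_rank G X"
    "coords (tensions_off X :: ('b \<Rightarrow> 'k) set) B"
    using ex_coords_tensions_off[OF assms] .
  then show ?thesis
    using coset_weight_off[of tensions_off X B z, OF submod_tensions_off submod_tensions_off]
    by (simp add: tensions_off_empty) (simp add: tensions_off_def)
qed

lemma coset_weight_flows_off:
  assumes "X \<subseteq> arcs G"
  shows "coset_weight (flows G) (flows_off X :: ('b \<Rightarrow> 'k::{idom, ring_char_0}) set) z
    = z ^ graph_nullity G (arcs G - X)"
proof -
  obtain B where "finite B" "card B = graph_nullity G (arcs G - X)"
    "coords (flows_off X :: ('b \<Rightarrow> 'k) set) B"
    using ex_coords_flows_off[OF assms] .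
  then show ?thesis
    using coset_weight_off[of flows_off X B z, OF submod_flows_off submod_flows_off]
    by (simp add: flows_off_empty) (simp add: flows_off_def)
qed

text \<open>If \<open>H\<close> is the translate of \<open>K\<close> by \<open>a\<close>, then 0 in
  \<open>H\<close> puts \<open>- a\<close>, hence \<open>a\<close>, into \<open>K\<close>, and the
  translate is \<open>K\<close> itself.\<close>

lemma direction_submod:
  assumes "submod H"
  shows "direction H = H"
  unfolding direction_def
proof (rule the_equality)
  show "submod H \<and> (\<exists>a. H = (+) a ` H)"
    using assms by (auto intro!: exI[of _ 0] simp: image_def)
next
  fix K assume K: "submod K \<and> (\<exists>a. H = (+) a ` K)"
  then obtain a where a: "H = (+) a ` K" by auto
  have "0 \<in> H" using assms by (simp add: submod_iff)
  then obtain k where k: "k \<in> K" "a + k = 0" using a by auto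
  then have "a = 0 - k" by (simp add: eq_neg_iff_add_eq_0)
  then have aK: "a \<in> K" using K k submod_diff[of K 0 k] by (auto simp: submod_iff)
  have "x \<in> (+) a ` K" if "x \<in> K" for x
    by (rule image_eqI[of _ _ "x - a"]) (use that aK K submod_diff in auto)
  then show "K = H" using a aK K by (auto simp: submod_iff)
qed

text \<open>A loop carries the flow with value 1 on it alone; any other edge has tension 1 under the
  indicator potential of its head. This separates the top of the intersection poset from all other
  members.\<close>

lemma Omega_edge_proper:
  assumes "e \<in> arcs G"
  shows "\<not> tensions G \<times> flows G \<subseteq> (tensions_off {e} \<times> flows_off {e}
    :: (('b \<Rightarrow> 'k::comm_ring_1) \<times> ('b \<Rightarrow> 'k)) set)"
proof (cases "tail G e = head G e")
  case True
  define g :: "'b \<Rightarrow> 'k" where "g d = (if d = e then 1 else 0)" for d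
  have "boundary g v = 0" for v
    using boundary_single[OF assms, of 1 v] True unfolding g_def by simp
  then have "g \<in> flows G" using assms by (auto simp: flows_boundary g_def fun_eq_iff)
  moreover have "g \<notin> flows_off {e}" by (simp add: flows_off_def g_def)
  moreover have "(0 :: 'b \<Rightarrow> 'k) \<in> tensions G"
    using submod_tensions_off[where 'k = 'k and X = "{}"] by (simp add: submod_iff tensions_off_empty)
  ultimately show ?thesis by blast
next
  case False
  define p :: "'a \<Rightarrow> 'k" where "p v = (if v = head G e then 1 else 0)" for v
  define f where "f d = (if d \<in> arcs G then p (head G d) - p (tail G d) else 0)" for d
  have "f \<in> tensions G" by (auto simp: tensions_potential f_def)
  moreover have "f \<notin> tensions_off {e}" using assms False by (simp add: tensions_off_def f_def p_def)
  moreover have "(0 :: 'b \<Rightarrow> 'k) \<in> flows G"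
    using submod_flows_off[where 'k = 'k and X = "{}"] by (simp add: submod_iff flows_off_empty)
  ultimately show ?thesis by blast
qed

lemma tf_char_poly_eq:
  "tf_char_poly TYPE('k::{idom, ring_char_0}) G = (\<Sum>X\<in>Pow (arcs G). (- 1) ^ card X
    * var_x ^ (graph_rank G (arcs G) - graph_rank G X) * var_y ^ graph_nullity G (arcs G - X))"
proof -
  define W where "W X = (tensions_off X \<times> flows_off X :: (('b \<Rightarrow> 'k) \<times> ('b \<Rightarrow> 'k)) set)" for X
  define P where "P = intersection_poset (tensions G \<times> flows G :: (('b \<Rightarrow> 'k) \<times> ('b \<Rightarrow> 'k)) set)
    (tf_arrangement G)"
  \<comment> \<open>Whitney's candidate for the Moebius function. \<open>W\<close> need not be
    injective: in a triangle, two edges and all three give the same intersection.\<close>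
  define \<nu> :: "(('b \<Rightarrow> 'k) \<times> ('b \<Rightarrow> 'k)) set \<Rightarrow> int"
    where "\<nu> Y = (\<Sum>X\<in>{X \<in> Pow (arcs G). W X = Y}. (- 1) ^ card X)" for Y
  have W_Inter: "W X = tensions G \<times> flows G \<inter> (\<Inter>e\<in>X. Omega_edge G e)" for X
    unfolding W_def Omega_edge_Inter[symmetric] Omega_def ..
  have zero: "0 \<in> (tensions_off X :: ('b \<Rightarrow> 'k) set)" "0 \<in> (flows_off X :: ('b \<Rightarrow> 'k) set)" for X
    using submod_tensions_off[where 'k = 'k and X = X] submod_flows_off[where 'k = 'k and X = X]
    by (auto simp: submod_iff)
  then have W_ne: "W X \<noteq> {}" for X by (auto simp: W_def)
  have P: "P = W ` Pow (arcs G)"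
  proof -
    have "{tensions G \<times> flows G \<inter> \<Inter>\<B> |\<B>. \<B> \<subseteq> tf_arrangement G} = W ` Pow (arcs G)"
      unfolding tf_arrangement_def subset_image_iff W_Inter by auto
    then show ?thesis using W_ne unfolding P_def intersection_poset_def by auto
  qed
  have top: "W {} = tensions G \<times> flows G" by (simp add: W_Inter)
  have moebius: "moebius P Y (W {}) = \<nu> Y" if "Y \<in> P" for Y
  proof (rule moebius_eqI)
    fix Z assume Z: "Z \<in> P"
    then obtain Y where Y: "Y \<subseteq> arcs G" "Z = W Y" by (auto simp: P)
    \<comment> \<open>\<open>Z\<close> lies in \<open>W X\<close> exactly when
      \<open>X \<subseteq> A\<close>, so the sum above \<open>Z\<close> becomes an alternating sum
      over \<open>Pow A\<close>.\<close>
    define A where "A = {e \<in> arcs G. Z \<subseteq> Omega_edge G e}"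
    have "(\<Sum>z\<in>{z \<in> P. Z \<subseteq> z}. \<nu> z) = (\<Sum>X\<in>{X \<in> Pow (arcs G). Z \<subseteq> W X}. (- 1) ^ card X)"
    proof -
      have "{z \<in> P. Z \<subseteq> z} = W ` {X \<in> Pow (arcs G). Z \<subseteq> W X}" by (auto simp: P)
      then have "(\<Sum>z\<in>{z \<in> P. Z \<subseteq> z}. \<nu> z) = (\<Sum>z\<in>W ` {X \<in> Pow (arcs G). Z \<subseteq> W X}.
          \<Sum>X\<in>{X \<in> {X \<in> Pow (arcs G). Z \<subseteq> W X}. W X = z}. (- 1) ^ card X)"
        unfolding \<nu>_def by (auto intro!: sum.cong)
      also have "\<dots> = (\<Sum>X\<in>{X \<in> Pow (arcs G). Z \<subseteq> W X}. (- 1) ^ card X)"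
        by (rule sum.image_gen[symmetric]) simp
      finally show ?thesis .
    qed
    also have "{X \<in> Pow (arcs G). Z \<subseteq> W X} = Pow A"
    proof -
      have "Z \<subseteq> W {}" using Y(2) unfolding W_Inter by auto
      then show ?thesis by (auto simp: A_def W_Inter)
    qed
    also have "(\<Sum>X\<in>Pow A. (- 1 :: int) ^ card X) = (if A = {} then 1 else 0)"
      by (rule sum_Pow_alternating) (simp add: A_def)
    also have "A = {} \<longleftrightarrow> Z = W {}"
    proof
      assume "A = {}"
      moreover have "Y \<subseteq> A" using Y by (auto simp: A_def W_Inter)
      ultimately show "Z = W {}" using Y by simp
    next
      assume "Z = W {}"
      then have "e \<notin> A" for e
        using Omega_edge_proper[where 'k = 'k and e = e] unfolding A_def W_def[symmetric] top[symmetric]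
        by (auto simp: W_Inter)
      then show "A = {}" by blast
    qed
    finally show "(\<Sum>z\<in>{z \<in> P. Z \<subseteq> z}. \<nu> z) = (if Z = W {} then 1 else 0)" by simp
  qed (use that in \<open>auto simp: P W_Inter\<close>)
  have weight: "coset_weight (tensions G) (direction (fst ` W X)) var_x
      * coset_weight (flows G) (direction (snd ` W X)) var_y
      = var_x ^ (graph_rank G (arcs G) - graph_rank G X) * var_y ^ graph_nullity G (arcs G - X)"
    if "X \<subseteq> arcs G" for X
  proof -
    \<comment> \<open>A product projects onto a factor when the other one is non-empty; both contain
      0.\<close>
    have "fst ` W X = tensions_off X" "snd ` W X = flows_off X"
      using zero[of X] by (auto simp: W_def image_iff)
    then show ?thesis using that
      by (simp add: direction_submod submod_tensions_off submod_flows_off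
          coset_weight_tensions_off coset_weight_flows_off)
  qed
  let ?w = "\<lambda>Y. coset_weight (tensions G) (direction (fst ` Y)) var_x
      * coset_weight (flows G) (direction (snd ` Y)) var_y"
  have "tf_char_poly TYPE('k) G = (\<Sum>Y\<in>P. of_int (\<nu> Y) * ?w Y)"
    unfolding tf_char_poly_def char_poly_def P_def[symmetric]
    by (rule sum.cong) (simp_all add: moebius[unfolded top] mult.assoc)
  also have "\<dots> = (\<Sum>Y\<in>P. \<Sum>X\<in>{X \<in> Pow (arcs G). W X = Y}. (- 1) ^ card X * ?w (W X))"
    by (simp add: \<nu>_def sum_distrib_right)
  also have "\<dots> = (\<Sum>X\<in>Pow (arcs G). (- 1) ^ card X * ?w (W X))"
    unfolding P by (rule sum.image_gen[symmetric]) simp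
  also have "\<dots> = (\<Sum>X\<in>Pow (arcs G). (- 1) ^ card X
      * var_x ^ (graph_rank G (arcs G) - graph_rank G X) * var_y ^ graph_nullity G (arcs G - X))"
    by (rule sum.cong) (auto simp only: weight mult.assoc Pow_iff)
  finally show ?thesis .
qed

section \<open>Counting over finite groups\<close>

lemma card_Omega_nz:
  "rat_of_nat (card (Omega_nz G :: (('b \<Rightarrow> 'x::{finite, ab_group_add}) \<times> ('b \<Rightarrow> 'y::{finite, ab_group_add})) set))
    = (\<Sum>X\<in>Pow (arcs G). (- 1) ^ card X * of_nat CARD('x) ^ (graph_rank G (arcs G) - graph_rank G X)
        * of_nat CARD('y) ^ graph_nullity G (arcs G - X))"
proof -
  let ?\<Omega> = "Omega G :: (('b \<Rightarrow> 'x) \<times> ('b \<Rightarrow> 'y)) set"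
  have card_tensions: "card (tensions_off X :: ('b \<Rightarrow> 'x) set)
      = CARD('x) ^ (graph_rank G (arcs G) - graph_rank G X)" if X: "X \<subseteq> arcs G" for X
  proof -
    obtain B where B: "finite B" "card B = graph_rank G (arcs G) - graph_rank G X"
      "coords (tensions_off X :: ('b \<Rightarrow> 'x) set) B"
      using ex_coords_tensions_off[OF X] .
    show ?thesis using card_coords[OF tensions_off_diff B(1,3)] by (simp add: B(2))
  qed
  have card_flows: "card (flows_off X :: ('b \<Rightarrow> 'y) set) = CARD('y) ^ graph_nullity G (arcs G - X)"
    if X: "X \<subseteq> arcs G" for X
  proof -
    obtain B where B: "finite B" "card B = graph_nullity G (arcs G - X)"
      "coords (flows_off X :: ('b \<Rightarrow> 'y) set) B"
      using ex_coords_flows_off[OF X] .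
    show ?thesis using card_coords[OF flows_off_diff B(1,3)] by (simp add: B(2))
  qed
  note card_off = card_tensions card_flows
  \<comment> \<open>The edge type may be infinite, so finiteness of \<open>?\<Omega>\<close> is read
    off from its cardinality: \<open>card\<close> of an infinite set is 0.\<close>
  have "card ?\<Omega> \<noteq> 0"
    using card_off[of "{}"] by (simp add: Omega_def tensions_off_empty flows_off_empty card_cartesian_product)
  then have fin: "finite ?\<Omega>" by (metis card.infinite)
  have val: "valuation_on (Pow ?\<Omega>) (\<lambda>S. rat_of_nat (card S))"
    unfolding valuation_on_def
  proof (intro conjI ballI)
    fix S S' assume "S \<in> Pow ?\<Omega>" "S' \<in> Pow ?\<Omega>"
    then have "finite S" "finite S'" using fin by (auto intro: finite_subset)
    then show "rat_of_nat (card (S \<union> S')) = rat_of_nat (card S) + rat_of_nat (card S') - rat_of_nat (card (S \<inter> S'))"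
      using card_Un_Int[of S S'] by (simp flip: of_nat_add)
  qed simp
  have "Omega_nz G = ?\<Omega> - (\<Union>e\<in>arcs G. Omega_edge G e)"
    by (auto simp: Omega_nz_def Omega_edge_def)
  then have "rat_of_nat (card (Omega_nz G :: (('b \<Rightarrow> 'x) \<times> ('b \<Rightarrow> 'y)) set))
      = (\<Sum>X\<in>Pow (arcs G). (- 1) ^ card X * of_nat (card (?\<Omega> \<inter> (\<Inter>e\<in>X. Omega_edge G e))))"
    using valuation_inclusion_exclusion[OF val, of "arcs G" ?\<Omega> "Omega_edge G"]
    by (auto simp: Omega_edge_def)
  also have "\<dots> = (\<Sum>X\<in>Pow (arcs G). (- 1) ^ card X
      * of_nat CARD('x) ^ (graph_rank G (arcs G) - graph_rank G X)
      * of_nat CARD('y) ^ graph_nullity G (arcs G - X))"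
    unfolding Omega_edge_Inter by (rule sum.cong) (simp_all add: card_cartesian_product card_off)
  finally show ?thesis .
qed

end

section \<open>The generated set algebra and the valuation\<close>

lemma generated_algebra_subset:
  assumes "S \<in> generated_algebra M \<G>" "\<And>S. S \<in> \<G> \<Longrightarrow> S \<subseteq> M"
  shows "S \<subseteq> M"
  using assms by (induction rule: generated_algebra.induct) auto

lemma generated_algebra_Int:
  assumes "\<And>S. S \<in> \<G> \<Longrightarrow> S \<subseteq> M" "S \<in> generated_algebra M \<G>" "S' \<in> generated_algebra M \<G>"
  shows "S \<inter> S' \<in> generated_algebra M \<G>"
proof -
  have "S \<inter> S' = M - ((M - S) \<union> (M - S'))"
    using generated_algebra_subset[OF assms(2,1)] by auto
  then show ?thesis using assms by (simp add: generated_algebra.compl generated_algebra.union)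
qed

lemma generated_algebra_Diff:
  assumes "\<And>S. S \<in> \<G> \<Longrightarrow> S \<subseteq> M" "S \<in> generated_algebra M \<G>" "S' \<in> generated_algebra M \<G>"
  shows "S - S' \<in> generated_algebra M \<G>"
proof -
  have "S - S' = S \<inter> (M - S')" using generated_algebra_subset[OF assms(2,1)] by auto
  then show ?thesis using generated_algebra_Int[OF assms(1)] assms(2,3)
    by (simp add: generated_algebra.compl)
qed

lemma cosets_in_subset: "submod M \<Longrightarrow> C \<in> cosets_in M \<Longrightarrow> C \<subseteq> M"
  by (auto simp: cosets_in_def submod_iff)

lemma submod_in_cosets_in: "submod M \<Longrightarrow> submod H \<Longrightarrow> H \<subseteq> M \<Longrightarrow> H \<in> cosets_in M"
  unfolding cosets_in_def by (intro CollectI exI[of _ 0] exI[of _ H]) (auto simp: submod_iff image_iff)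

text \<open>Every intersection of members of the arrangement is a product of two submodules, and
  there the values of \<open>v\<close> are prescribed; inclusion-exclusion carries them to the
  complement.\<close>

lemma (in fin_digraph) tf_valuation_complement:
  fixes v :: "(('b \<Rightarrow> 'k::{idom, ring_char_0}) \<times> ('b \<Rightarrow> 'k)) set \<Rightarrow> rat poly poly"
  assumes "tf_valuation G v"
  shows "v (Omega G - (\<Union>e\<in>arcs G. Omega_edge G e)) = tf_char_poly TYPE('k) G"
proof -
  let ?\<R> = "product_coset_algebra (tensions G :: ('b \<Rightarrow> 'k) set) (flows G)"
  have sub: "submod (tensions G :: ('b \<Rightarrow> 'k) set)" "submod (flows G :: ('b \<Rightarrow> 'k) set)"
    using submod_tensions_off[of "{}"] submod_flows_off[of "{}"]
    by (simp_all add: tensions_off_empty flows_off_empty)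
  have off_sub: "(tensions_off X :: ('b \<Rightarrow> 'k) set) \<subseteq> tensions G" "(flows_off X :: ('b \<Rightarrow> 'k) set) \<subseteq> flows G" for X
    by (auto simp: tensions_off_def flows_off_def)
  have val: "valuation_on ?\<R> v"
    and prod: "\<And>H1 H2. submod H1 \<Longrightarrow> H1 \<subseteq> tensions G \<Longrightarrow> submod H2 \<Longrightarrow> H2 \<subseteq> flows G \<Longrightarrow>
      v (H1 \<times> H2) = coset_weight (tensions G) H1 var_x * coset_weight (flows G) H2 var_y"
    using assms by (auto simp: tf_valuation_def ti_product_valuation_def)
  have gen: "S \<subseteq> tensions G \<times> flows G"
    if "S \<in> {C1 \<times> C2 |C1 C2. C1 \<in> cosets_in (tensions G :: ('b \<Rightarrow> 'k) set)
      \<and> C2 \<in> cosets_in (flows G :: ('b \<Rightarrow> 'k) set)}" for S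
    using that cosets_in_subset[OF sub(1)] cosets_in_subset[OF sub(2)] by blast
  have off_in: "tensions_off X \<times> flows_off X \<in> ?\<R>" for X
    unfolding product_coset_algebra_def
    using submod_in_cosets_in[OF sub(1) submod_tensions_off off_sub(1)]
      submod_in_cosets_in[OF sub(2) submod_flows_off off_sub(2)]
    by (intro generated_algebra.basic CollectI exI[of _ "tensions_off X"] exI[of _ "flows_off X"]) simp
  have edge: "Omega_edge G e = tensions_off {e} \<times> flows_off {e}" for e
    by (auto simp: Omega_edge_def Omega_def tensions_off_def flows_off_def)
  have "v (Omega G - (\<Union>e\<in>arcs G. Omega_edge G e))
      = (\<Sum>X\<in>Pow (arcs G). (- 1) ^ card X * v (Omega G \<inter> (\<Inter>e\<in>X. Omega_edge G e)))"
  proof (rule valuation_inclusion_exclusion[OF val])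
    show "Omega G \<in> ?\<R>"
      using off_in[of "{}"] by (simp add: Omega_def tensions_off_empty flows_off_empty)
    show "S \<inter> S' \<in> ?\<R>" if "S \<in> ?\<R>" "S' \<in> ?\<R>" for S S'
      using generated_algebra_Int[OF gen that[unfolded product_coset_algebra_def]]
      unfolding product_coset_algebra_def by simp
    show "S - S' \<in> ?\<R>" if "S \<in> ?\<R>" "S' \<in> ?\<R>" for S S'
      using generated_algebra_Diff[OF gen that[unfolded product_coset_algebra_def]]
      unfolding product_coset_algebra_def by simp
    show "Omega_edge G e \<in> ?\<R>" for e
      unfolding edge by (rule off_in)
  qed simp
  also have "\<dots> = tf_char_poly TYPE('k) G"
    unfolding Omega_edge_Inter tf_char_poly_eq
    by (rule sum.cong) (auto simp only: prod[OF submod_tensions_off off_sub(1) submod_flows_off off_sub(2)]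
        coset_weight_tensions_off coset_weight_flows_off mult.assoc Pow_iff)
  finally show ?thesis .
qed

theorem theorem3p1:
  fixes G :: "('v, 'e) pre_digraph"
    and p q :: nat
  assumes "fin_digraph G"
    and "CARD('a::{finite, ab_group_add}) = p" and "CARD('b::{finite, ab_group_add}) = q"
  shows
    "(rat_of_nat (card (Omega_nz G :: (('e \<Rightarrow> 'a) \<times> ('e \<Rightarrow> 'b)) set)) =
        eval2 (tf_char_poly TYPE(int) G) (of_nat p) (of_nat q) \<and>
      tf_char_poly TYPE(int) G =
        (\<Sum>X\<in>Pow (arcs G). (- 1) ^ card X * var_x ^ (graph_rank G (arcs G) - graph_rank G X)
           * var_y ^ graph_nullity G (arcs G - X)) \<and>
      (\<forall>v :: (('e \<Rightarrow> int) \<times> ('e \<Rightarrow> int)) set \<Rightarrow> rat poly poly. tf_valuation G v \<longrightarrow>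
         eval2 (tf_char_poly TYPE(int) G) (of_nat p) (of_nat q) =
           eval2 (v (Omega G - (\<Union>e\<in>arcs G. Omega_edge G e))) (of_nat p) (of_nat q) \<and>
         tf_char_poly TYPE(int) G = v (Omega G - (\<Union>e\<in>arcs G. Omega_edge G e)))) \<and>
     (rat_of_nat (card (Omega_nz G :: (('e \<Rightarrow> 'a) \<times> ('e \<Rightarrow> 'b)) set)) =
        eval2 (tf_char_poly TYPE(rat) G) (of_nat p) (of_nat q) \<and>
      tf_char_poly TYPE(rat) G =
        (\<Sum>X\<in>Pow (arcs G). (- 1) ^ card X * var_x ^ (graph_rank G (arcs G) - graph_rank G X)
           * var_y ^ graph_nullity G (arcs G - X)) \<and>
      (\<forall>v :: (('e \<Rightarrow> rat) \<times> ('e \<Rightarrow> rat)) set \<Rightarrow> rat poly poly. tf_valuation G v \<longrightarrow>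
         eval2 (tf_char_poly TYPE(rat) G) (of_nat p) (of_nat q) =
           eval2 (v (Omega G - (\<Union>e\<in>arcs G. Omega_edge G e))) (of_nat p) (of_nat q) \<and>
         tf_char_poly TYPE(rat) G = v (Omega G - (\<Union>e\<in>arcs G. Omega_edge G e)))) \<and>
     (rat_of_nat (card (Omega_nz G :: (('e \<Rightarrow> 'a) \<times> ('e \<Rightarrow> 'b)) set)) =
        eval2 (tf_char_poly TYPE(real) G) (of_nat p) (of_nat q) \<and>
      tf_char_poly TYPE(real) G =
        (\<Sum>X\<in>Pow (arcs G). (- 1) ^ card X * var_x ^ (graph_rank G (arcs G) - graph_rank G X)
           * var_y ^ graph_nullity G (arcs G - X)) \<and>
      (\<forall>v :: (('e \<Rightarrow> real) \<times> ('e \<Rightarrow> real)) set \<Rightarrow> rat poly poly. tf_valuation G v \<longrightarrow>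
         eval2 (tf_char_poly TYPE(real) G) (of_nat p) (of_nat q) =
           eval2 (v (Omega G - (\<Union>e\<in>arcs G. Omega_edge G e))) (of_nat p) (of_nat q) \<and>
         tf_char_poly TYPE(real) G = v (Omega G - (\<Union>e\<in>arcs G. Omega_edge G e)))) \<and>
     (rat_of_nat (card (Omega_nz G :: (('e \<Rightarrow> 'a) \<times> ('e \<Rightarrow> 'b)) set)) =
        eval2 (tf_char_poly TYPE(complex) G) (of_nat p) (of_nat q) \<and>
      tf_char_poly TYPE(complex) G =
        (\<Sum>X\<in>Pow (arcs G). (- 1) ^ card X * var_x ^ (graph_rank G (arcs G) - graph_rank G X)
           * var_y ^ graph_nullity G (arcs G - X)) \<and>
      (\<forall>v :: (('e \<Rightarrow> complex) \<times> ('e \<Rightarrow> complex)) set \<Rightarrow> rat poly poly. tf_valuation G v \<longrightarrow>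
         eval2 (tf_char_poly TYPE(complex) G) (of_nat p) (of_nat q) =
           eval2 (v (Omega G - (\<Union>e\<in>arcs G. Omega_edge G e))) (of_nat p) (of_nat q) \<and>
         tf_char_poly TYPE(complex) G = v (Omega G - (\<Union>e\<in>arcs G. Omega_edge G e))))"
proof -
  interpret fin_digraph G by fact
  show ?thesis
    \<comment> \<open>All four coefficient rings are domains of characteristic zero; each equation
      turns into an identity of one subset sum, or of its value at \<open>p\<close> and
      \<open>q\<close>.\<close>
    by (intro conjI allI impI)
      (simp_all only: card_Omega_nz assms(2,3) tf_valuation_complement tf_char_poly_eq
        eval2_sum eval2_monomial)
qed

end
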